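(* Let $\mathcal{H}=\{H(G): G \text{ a finite simple graph}\}$. Then $$\mathcal{H}\cap[0,4]=\{0,1,2,5/2,3,7/2,11/3,4\}.$$
   Context: For an integer $q \ge 2$ let $[q]=\{0,\dots,q-1\}$. For $f=(f_1,\dots,f_n):[q]^n\to[q]^n$, the interaction graph $\mathrm{IG}(f)$ is the digraph on $\{1,\dots,n\}$ with an arc $(u,v)$ iff $f_v$ depends essentially on $x_u$ (there exist $a,b\in[q]^n$ differing only in coordinate $u$ with $f_v(a)\ne f_v(b)$). A simple graph is viewed as the digraph with both arcs for each edge and no loops. The $q$-guessing number is $\mathrm{gn}(G,q)=\max\{\log_q|\mathrm{Fix}(f)| : \mathrm{IG}(f)\subseteq G\}$, where $\mathrm{Fix}(f)=\{x:f(x)=x\}$, and the entropy is $H(G)=\sup_{q\ge2}\mathrm{gn}(G,q)$. *)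

theory Defs
  imports Complex_Main "HOL-Library.FuncSet"
begin

text \<open>Vertices are 0,...,n-1 (a relabelling of 1..n). A finite simple graph on
  these vertices is an irreflexive symmetric relation E restricted to that set.\<close>

definition simple_graph :: "nat \<Rightarrow> (nat \<Rightarrow> nat \<Rightarrow> bool) \<Rightarrow> bool" where
  "simple_graph n E \<longleftrightarrow>
     (\<forall>u<n. \<forall>v<n. E u v \<longrightarrow> E v u) \<and> (\<forall>v<n. \<not> E v v)"

definition configs :: "nat \<Rightarrow> nat \<Rightarrow> (nat \<Rightarrow> nat) set" where
  "configs n q = PiE {..<n} (\<lambda>_. {..<q})"

definition depends :: "nat \<Rightarrow> nat \<Rightarrow> ((nat \<Rightarrow> nat) \<Rightarrow> (nat \<Rightarrow> nat)) \<Rightarrow> nat \<Rightarrow> nat \<Rightarrow> bool" where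
  "depends n q f u v \<longleftrightarrow>
     (\<exists>a\<in>configs n q. \<exists>b\<in>configs n q.
        (\<forall>w<n. w \<noteq> u \<longrightarrow> a w = b w) \<and> f a v \<noteq> f b v)"

definition IG_sub :: "nat \<Rightarrow> nat \<Rightarrow> ((nat \<Rightarrow> nat) \<Rightarrow> (nat \<Rightarrow> nat)) \<Rightarrow> (nat \<Rightarrow> nat \<Rightarrow> bool) \<Rightarrow> bool" where
  "IG_sub n q f E \<longleftrightarrow> (\<forall>u<n. \<forall>v<n. depends n q f u v \<longrightarrow> E u v)"

definition Fix :: "nat \<Rightarrow> nat \<Rightarrow> ((nat \<Rightarrow> nat) \<Rightarrow> (nat \<Rightarrow> nat)) \<Rightarrow> (nat \<Rightarrow> nat) set" where
  "Fix n q f = {x \<in> configs n q. f x = x}"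

definition guessing_number :: "nat \<Rightarrow> (nat \<Rightarrow> nat \<Rightarrow> bool) \<Rightarrow> nat \<Rightarrow> real" where
  "guessing_number n E q =
     Max {log (real q) (real (card (Fix n q f))) | f.
            (\<forall>x\<in>configs n q. f x \<in> configs n q) \<and> IG_sub n q f E}"

definition entropy :: "nat \<Rightarrow> (nat \<Rightarrow> nat \<Rightarrow> bool) \<Rightarrow> real" where
  "entropy n E = (SUP q\<in>{2..}. guessing_number n E q)"

definition entropy_set :: "real set" where
  "entropy_set = {entropy n E | n E. simple_graph n E}"

end

theory Submission
  imports Defs
begin

text \<open>A set of fixed points of maps with interaction graph inside \<open>G\<close> is a code in which each
  coordinate is determined by its neighbours. Upper bounds on the entropy come from
  submodularity of the Shannon entropy of a uniform codeword, lower bounds from fractional clique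
  covers: a cover of weight \<open>k\<close> gives \<open>H(G) \<ge> n - k\<close>.

  If an independent set \<open>I\<close> has at most \<open>|I|\<close> neighbours, Hall's theorem matches \<open>N(I)\<close> into a
  suitable such \<open>I\<close>, so that \<open>H(G) = |N(I)| + H(G - I - N(I))\<close>. When no such \<open>I\<close> is left, Hall's
  theorem yields a permutation moving every vertex to a neighbour, whose arcs form a clique
  cover of weight \<open>n/2\<close>. Hence \<open>H(G) \<ge> n/2\<close>, and only kernels with \<open>n \<le> 7\<close> can have entropy below 4.
  For these the cycles of the permutation leave few graphs: complete graphs, the 5-cycle, the
  5-cycle with an apex joined to at least three consecutive vertices, spanning subgraphs of the 7-cycle
  with three disjoint chords, and a graph with entropy 11/3 that consists of a 5-cycle, a triangle on one
  of its edges, and a path of length two joining the apex of the triangle to the opposite vertex. All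
  other kernels have integral clique covers that match \<open>n - \<alpha>\<close> or show that the entropy is at least 4.\<close>

subsection \<open>Entropy of projections\<close>

text \<open>The tangent bound ln r <= r - 1, summed over \<open>X\<close>. Submodularity and the
  bound for a single coordinate both follow from a suitable choice of the ratio
  \<open>r\<close>.\<close>

lemma sum_log_nonpos:
  assumes "finite X" "b > 1" "\<And>x. x \<in> X \<Longrightarrow> r x > 0" "(\<Sum>x\<in>X. r x) \<le> real (card X)"
  shows "(\<Sum>x\<in>X. log b (r x)) \<le> 0"
proof -
  have "(\<Sum>x\<in>X. log b (r x)) \<le> (\<Sum>x\<in>X. (r x - 1) / ln b)"
    using assms by (intro sum_mono) (auto simp: log_def intro!: divide_right_mono ln_le_minus_one)
  also have "\<dots> = ((\<Sum>x\<in>X. r x) - real (card X)) / ln b"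
    by (simp add: sum_divide_distrib[symmetric] sum_subtractf)
  also have "\<dots> \<le> 0"
    using assms by (intro divide_nonpos_pos) auto
  finally show ?thesis .
qed

text \<open>For a uniform random element of \<open>X\<close>, \<open>fiber X s x / card X\<close> is
  the probability of the value \<open>s x\<close>.\<close>

definition fiber :: "'x set \<Rightarrow> ('x \<Rightarrow> 'k) \<Rightarrow> 'x \<Rightarrow> nat" where
  "fiber X s x = card {y \<in> X. s y = s x}"

lemma fiber_pos: "finite X \<Longrightarrow> x \<in> X \<Longrightarrow> fiber X s x > 0"
  unfolding fiber_def by (subst card_gt_0_iff) auto

text \<open>Within one fibre the terms are equal and add up to 1.\<close>

lemma sum_inverse_fiber:
  assumes "finite X"
  shows "(\<Sum>x\<in>X. 1 / real (fiber X s x)) = real (card (s ` X))"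
proof -
  have "(\<Sum>x\<in>X. 1 / real (fiber X s x)) = (\<Sum>k\<in>s ` X. \<Sum>x\<in>{x\<in>X. s x = k}. 1 / real (fiber X s x))"
    by (rule sum.image_gen[OF assms])
  also have "\<dots> = (\<Sum>k\<in>s ` X. 1)"
  proof (rule sum.cong)
    fix k assume "k \<in> s ` X"
    then have "{x\<in>X. s x = k} \<noteq> {}" by auto
    moreover have "(\<Sum>x\<in>{x\<in>X. s x = k}. 1 / real (fiber X s x)) =
        (\<Sum>x\<in>{x\<in>X. s x = k}. 1 / real (card {x\<in>X. s x = k}))"
      by (intro sum.cong) (auto simp: fiber_def)
    ultimately show "(\<Sum>x\<in>{x\<in>X. s x = k}. 1 / real (fiber X s x)) = 1"
      using assms by simp
  qed simp
  finally show ?thesis by simp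
qed

text \<open>Expanding the product of fibre sizes as a count of pairs \<open>(y, z)\<close>, every pair with
  \<open>w y = w z\<close> is hit by at most one fibre of \<open>(s, t)\<close>.\<close>

lemma sum_fiber_ratio:
  fixes s :: "'x \<Rightarrow> 's" and t :: "'x \<Rightarrow> 't" and w :: "'x \<Rightarrow> 'w"
  assumes "finite X"
    and ws: "\<And>x y. x \<in> X \<Longrightarrow> y \<in> X \<Longrightarrow> s x = s y \<Longrightarrow> w x = w y"
    and wt: "\<And>x y. x \<in> X \<Longrightarrow> y \<in> X \<Longrightarrow> t x = t y \<Longrightarrow> w x = w y"
    and stu: "\<And>x y. x \<in> X \<Longrightarrow> y \<in> X \<Longrightarrow> s x = s y \<Longrightarrow> t x = t y \<Longrightarrow> u x = u y"
  shows "(\<Sum>x\<in>X. real (fiber X s x) * real (fiber X t x) / (real (fiber X u x) * real (fiber X w x)))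
         \<le> real (card X)"
proof -
  define p where "p = (\<lambda>x. (s x, t x))"
  let ?I = "\<lambda>P. if P then 1 else (0::real)"
  have ind: "real (fiber X s x) = (\<Sum>y\<in>X. ?I (s y = s x))" for x
    using assms(1) by (simp add: fiber_def sum.If_cases Int_def)
  have ind': "real (fiber X t x) = (\<Sum>y\<in>X. ?I (t y = t x))" for x
    using assms(1) by (simp add: fiber_def sum.If_cases Int_def)
  have ind'': "real (fiber X w x) = (\<Sum>y\<in>X. ?I (w y = w x))" for x
    using assms(1) by (simp add: fiber_def sum.If_cases Int_def)
  \<comment> \<open>The pair \<open>p\<close> determines \<open>u\<close>, so its fibres are no
    larger, and replacing \<open>u\<close> by \<open>p\<close> can only increase the sum.\<close>
  have "(\<Sum>x\<in>X. real (fiber X s x) * real (fiber X t x) / (real (fiber X u x) * real (fiber X w x)))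
      \<le> (\<Sum>x\<in>X. real (fiber X s x) * real (fiber X t x) / (real (fiber X p x) * real (fiber X w x)))"
  proof (rule sum_mono)
    fix x assume x: "x \<in> X"
    have "fiber X p x \<le> fiber X u x"
      unfolding fiber_def using assms(1) x by (intro card_mono) (auto simp: p_def intro: stu)
    then show "real (fiber X s x) * real (fiber X t x) / (real (fiber X u x) * real (fiber X w x))
        \<le> real (fiber X s x) * real (fiber X t x) / (real (fiber X p x) * real (fiber X w x))"
      using fiber_pos[OF assms(1) x, of p] fiber_pos[OF assms(1) x, of w]
      by (intro divide_left_mono mult_right_mono) auto
  qed
  also have "\<dots> = (\<Sum>x\<in>X. \<Sum>y\<in>X. \<Sum>z\<in>X.
      ?I (s y = s x) * ?I (t z = t x) / (real (fiber X p x) * real (fiber X w x)))"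
    by (intro sum.cong refl) (simp only: ind ind' sum_product sum_divide_distrib)
  also have "\<dots> = (\<Sum>y\<in>X. \<Sum>x\<in>X. \<Sum>z\<in>X.
      ?I (s y = s x) * ?I (t z = t x) / (real (fiber X p x) * real (fiber X w x)))"
    by (rule sum.swap)
  also have "\<dots> = (\<Sum>y\<in>X. \<Sum>z\<in>X. \<Sum>x\<in>X.
      ?I (s y = s x) * ?I (t z = t x) / (real (fiber X p x) * real (fiber X w x)))"
    by (rule sum.cong[OF refl], rule sum.swap)
  also have "\<dots> \<le> (\<Sum>y\<in>X. \<Sum>z\<in>X. ?I (w z = w y) / real (fiber X w y))"
  proof (intro sum_mono)
    fix y z assume y: "y \<in> X" and z: "z \<in> X"
    let ?J = "{x\<in>X. s x = s y \<and> t x = t z}"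
    have eq: "(\<Sum>x\<in>X. ?I (s y = s x) * ?I (t z = t x) / (real (fiber X p x) * real (fiber X w x)))
        = (\<Sum>x\<in>?J. 1 / (real (fiber X p x) * real (fiber X w x)))"
      using assms(1) by (intro sum.mono_neutral_cong_right) auto
    show "(\<Sum>x\<in>X. ?I (s y = s x) * ?I (t z = t x) / (real (fiber X p x) * real (fiber X w x)))
        \<le> ?I (w z = w y) / real (fiber X w y)"
    proof (cases "?J = {}")
      case True
      then show ?thesis unfolding eq True by simp
    next
      case False
      then obtain x0 where x0: "x0 \<in> ?J" by auto
      then have w: "w z = w y" using ws[of x0 y] wt[of x0 z] y z by auto
      \<comment> \<open>On \<open>?J\<close> the fibre of \<open>p\<close> is \<open>?J\<close>
        itself, so the \<open>card ?J\<close> equal terms add up to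
        \<open>1 / fiber X w y\<close>.\<close>
      have "(\<Sum>x\<in>?J. 1 / (real (fiber X p x) * real (fiber X w x)))
          = (\<Sum>x\<in>?J. 1 / (real (card ?J) * real (fiber X w y)))"
      proof (rule sum.cong)
        fix x assume x: "x \<in> ?J"
        then have "w x = w y" using ws[of x y] y by auto
        moreover have "{y \<in> X. p y = p x} = ?J" using x by (auto simp: p_def)
        ultimately show "1 / (real (fiber X p x) * real (fiber X w x)) =
            1 / (real (card ?J) * real (fiber X w y))"
          by (simp add: fiber_def)
      qed simp
      also have "\<dots> = 1 / real (fiber X w y)"
        using False assms(1) by (simp add: card_gt_0_iff)
      finally show ?thesis using eq w by simp
    qed
  qed
  also have "\<dots> = (\<Sum>y\<in>X. 1)"
  proof (rule sum.cong)
    fix y assume "y \<in> X"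
    then show "(\<Sum>z\<in>X. ?I (w z = w y) / real (fiber X w y)) = 1"
      using fiber_pos[OF assms(1), of y w]
      by (simp add: sum_divide_distrib[symmetric] ind''[symmetric])
  qed simp
  finally show ?thesis by simp
qed

text \<open>The Shannon entropy, to base \<open>b\<close>, of the restriction to \<open>S\<close> of
  a uniform random element of \<open>X\<close>. Averaging over elements instead of over values keeps
  distributions implicit.\<close>

definition proj_entropy :: "real \<Rightarrow> ('a \<Rightarrow> 'b) set \<Rightarrow> 'a set \<Rightarrow> real" where
  "proj_entropy b X S =
     (\<Sum>x\<in>X. log b (real (card X) / real (fiber X (\<lambda>x. restrict x S) x))) / real (card X)"

lemma restrict_eq_iff: "restrict x S = restrict y S \<longleftrightarrow> (\<forall>v\<in>S. x v = y v)"
  by (auto simp: restrict_def fun_eq_iff)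

lemma proj_entropy_empty: "finite X \<Longrightarrow> X \<noteq> {} \<Longrightarrow> proj_entropy b X {} = 0"
  by (simp add: proj_entropy_def fiber_def restrict_eq_iff)

lemma proj_entropy_full:
  assumes "finite X" "X \<noteq> {}" "X \<subseteq> PiE V A"
  shows "proj_entropy b X V = log b (real (card X))"
proof -
  have "y = x" if "x \<in> X" "y \<in> X" "\<forall>v\<in>V. y v = x v" for x y
    using PiE_ext[of y V A x] that assms(3) by blast
  then have "{y \<in> X. restrict y V = restrict x V} = {x}" if "x \<in> X" for x
    using that unfolding restrict_eq_iff by blast
  then have "fiber X (\<lambda>x. restrict x V) x = 1" if "x \<in> X" for x
    using that by (simp add: fiber_def)
  then show ?thesis
    using assms by (simp add: proj_entropy_def)
qed

text \<open>The fibre ratio of \<open>sum_fiber_ratio\<close> goes into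
  \<open>sum_log_nonpos\<close>. Taking for \<open>U\<close> anything that \<open>S\<close> and
  \<open>T\<close> jointly determine on \<open>X\<close> builds functional dependence into
  submodularity.\<close>

lemma proj_entropy_submod:
  assumes "finite X" "X \<noteq> {}" "b > 1" "W \<subseteq> S" "W \<subseteq> T"
    and det: "\<And>x y. x \<in> X \<Longrightarrow> y \<in> X \<Longrightarrow> \<forall>v\<in>S. x v = y v \<Longrightarrow> \<forall>v\<in>T. x v = y v \<Longrightarrow> \<forall>v\<in>U. x v = y v"
  shows "proj_entropy b X U + proj_entropy b X W \<le> proj_entropy b X S + proj_entropy b X T"
proof -
  define f where "f = (\<lambda>S x. real (fiber X (\<lambda>x. restrict x S) x))"
  let ?N = "real (card X)"
  have N: "?N > 0" using assms by (simp add: card_gt_0_iff)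
  have pos: "f S x > 0" if "x \<in> X" for S x
    using fiber_pos[OF assms(1) that] by (simp add: f_def)
  have "(\<Sum>x\<in>X. log b (f S x * f T x / (f U x * f W x))) \<le> 0"
  proof (rule sum_log_nonpos)
    show "(\<Sum>x\<in>X. f S x * f T x / (f U x * f W x)) \<le> ?N"
      unfolding f_def
    proof (rule sum_fiber_ratio)
      fix x y assume *: "x \<in> X" "y \<in> X" "restrict x S = restrict y S" "restrict x T = restrict y T"
      then show "restrict x U = restrict y U"
        using det[of x y] unfolding restrict_eq_iff by blast
    qed (use assms in \<open>auto simp: restrict_eq_iff\<close>)
  qed (use assms pos in auto)
  moreover have "log b (f S x * f T x / (f U x * f W x)) =
      (log b (?N / f U x) + log b (?N / f W x)) - (log b (?N / f S x) + log b (?N / f T x))"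
    if "x \<in> X" for x
    using pos[OF that] N assms(3) by (simp add: log_divide log_mult less_imp_neq[symmetric])
  ultimately have "(\<Sum>x\<in>X. (log b (?N / f U x) + log b (?N / f W x)) - (log b (?N / f S x) + log b (?N / f T x))) \<le> 0"
    by simp
  moreover have "proj_entropy b X S = (\<Sum>x\<in>X. log b (?N / f S x)) / ?N" for S
    by (simp add: proj_entropy_def f_def)
  ultimately show ?thesis
    using N by (simp add: sum_subtractf sum.distrib add_divide_distrib[symmetric] divide_right_mono)
qed

text \<open>A coordinate takes at most \<open>q\<close> values, so by
  \<open>sum_inverse_fiber\<close> the ratios under the logarithm have mean at most 1 after division
  by \<open>q\<close>.\<close>

lemma proj_entropy_single:
  assumes "finite X" "X \<noteq> {}" "q > 1" "X \<subseteq> PiE V (\<lambda>_. {..<q})" "v \<in> V"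
  shows "proj_entropy (real q) X {v} \<le> 1"
proof -
  define f where "f = (\<lambda>x. real (fiber X (\<lambda>x. restrict x {v}) x))"
  let ?N = "real (card X)"
  have N: "?N > 0" using assms by (simp add: card_gt_0_iff)
  have pos: "f x > 0" if "x \<in> X" for x
    using fiber_pos[OF assms(1) that] by (simp add: f_def)
  have "card ((\<lambda>x. restrict x {v}) ` X) \<le> card ((\<lambda>a. restrict (\<lambda>_. a) {v}) ` {..<q})"
    using assms by (intro card_mono) (force simp: restrict_def fun_eq_iff)+
  also have "\<dots> \<le> q"
    using card_image_le[of "{..<q}"] by simp
  finally have c: "card ((\<lambda>x. restrict x {v}) ` X) \<le> q" .
  have "(\<Sum>x\<in>X. log q (?N / f x / q)) \<le> 0"
  proof (rule sum_log_nonpos)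
    have "(\<Sum>x\<in>X. ?N / f x / q) = ?N / q * (\<Sum>x\<in>X. 1 / f x)"
      by (simp add: sum_distrib_left mult_ac)
    also have "\<dots> = ?N / q * card ((\<lambda>x. restrict x {v}) ` X)"
      unfolding f_def by (subst sum_inverse_fiber[OF assms(1)]) simp
    also have "\<dots> \<le> ?N / q * q"
      using c by (intro mult_left_mono) auto
    finally show "(\<Sum>x\<in>X. ?N / f x / q) \<le> ?N" using assms by simp
  qed (use assms pos N in auto)
  moreover have "log q (?N / f x / q) = log q (?N / f x) - 1" if "x \<in> X" for x
    using pos[OF that] N assms(3) by (simp add: log_divide log_mult less_imp_neq[symmetric])
  ultimately have "(\<Sum>x\<in>X. log q (?N / f x)) \<le> ?N"
    by (simp add: sum_subtractf)
  moreover have "proj_entropy q X {v} = (\<Sum>x\<in>X. log q (?N / f x)) / ?N"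
    by (simp add: proj_entropy_def f_def)
  ultimately show ?thesis
    using N by simp
qed

subsection \<open>Codes and upper bounds\<close>

text \<open>The sets \<open>Fix f\<close> with interaction graph inside \<open>E\<close>, and their subsets, are exactly the codes.\<close>

definition code :: "('a \<Rightarrow> 'a \<Rightarrow> bool) \<Rightarrow> 'a set \<Rightarrow> nat \<Rightarrow> ('a \<Rightarrow> nat) set \<Rightarrow> bool" where
  "code E V q X \<longleftrightarrow> X \<subseteq> PiE V (\<lambda>_. {..<q}) \<and>
     (\<forall>x\<in>X. \<forall>y\<in>X. \<forall>v\<in>V. (\<forall>u\<in>V. E u v \<longrightarrow> x u = y u) \<longrightarrow> x v = y v)"

text \<open>Bounding codes instead of \<open>entropy\<close> makes the bound available on every
  vertex set, in particular on what is left after vertices are removed.\<close>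

definition UB :: "('a \<Rightarrow> 'a \<Rightarrow> bool) \<Rightarrow> 'a set \<Rightarrow> real \<Rightarrow> bool" where
  "UB E V h \<longleftrightarrow>
     (\<forall>q\<ge>2. \<forall>X. code E V q X \<longrightarrow> X \<noteq> {} \<longrightarrow> log (real q) (real (card X)) \<le> h)"

lemma finite_code: "finite V \<Longrightarrow> code E V q X \<Longrightarrow> finite X"
  unfolding code_def by (meson finite_PiE finite_lessThan finite_subset)

lemma codeD:
  "code E V q X \<Longrightarrow> x \<in> X \<Longrightarrow> y \<in> X \<Longrightarrow> v \<in> V \<Longrightarrow> (\<And>u. u \<in> V \<Longrightarrow> E u v \<Longrightarrow> x u = y u) \<Longrightarrow> x v = y v"
  unfolding code_def by blast

lemma code_subset: "code E V q X \<Longrightarrow> Y \<subseteq> X \<Longrightarrow> code E V q Y"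
  unfolding code_def by blast

text \<open>A constant coordinate gives its neighbours no information and distinguishes no two
  codewords, so it can be deleted.\<close>

lemma code_drop_constant:
  assumes "code E (insert v V) q X" "v \<notin> V" and const: "\<forall>x\<in>X. x v = a"
  shows "code E V q ((\<lambda>x. restrict x V) ` X)" "inj_on (\<lambda>x. restrict x V) X"
proof -
  have X: "X \<subseteq> PiE (insert v V) (\<lambda>_. {..<q})" using assms(1) by (simp add: code_def)
  have "restrict x V \<in> PiE V (\<lambda>_. {..<q})" if "x \<in> X" for x
    using that X by (auto simp: PiE_iff subset_iff)
  moreover have "x w = y w"
    if "x \<in> X" "y \<in> X" "w \<in> V" "\<And>u. u \<in> V \<Longrightarrow> E u w \<Longrightarrow> x u = y u" for x y w
  proof (rule codeD[OF assms(1) that(1,2)])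
    fix u assume "u \<in> insert v V" "E u w"
    then show "x u = y u" using that(1,2,4) const by (metis insert_iff)
  qed (use that in simp)
  ultimately show "code E V q ((\<lambda>x. restrict x V) ` X)"
    unfolding code_def by (auto simp: image_subset_iff)
  have "x = y" if "x \<in> X" "y \<in> X" "\<forall>w\<in>V. x w = y w" for x y
  proof (rule PiE_ext)
    show "x \<in> PiE (insert v V) (\<lambda>_. {..<q})" "y \<in> PiE (insert v V) (\<lambda>_. {..<q})"
      using X that by blast+
    show "x w = y w" if "w \<in> insert v V" for w
      using const \<open>x \<in> X\<close> \<open>y \<in> X\<close> \<open>\<forall>w\<in>V. x w = y w\<close> that by (metis insert_iff)
  qed
  then show "inj_on (\<lambda>x. restrict x V) X"
    unfolding inj_on_def restrict_eq_iff by blast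
qed

text \<open>A vertex without neighbours is determined by nothing at all, hence constant on the
  code.\<close>

lemma UB_insert_isolated:
  assumes "UB E V h" "\<And>u. u \<in> insert v V \<Longrightarrow> \<not> E u v"
  shows "UB E (insert v V) h"
proof (cases "v \<in> V")
  case False
  show ?thesis
    unfolding UB_def
  proof (intro allI impI)
    fix q :: nat and X assume q: "2 \<le> q" and X: "code E (insert v V) q X" "X \<noteq> {}"
    then obtain x0 where x0: "x0 \<in> X" by auto
    have "x v = x0 v" if "x \<in> X" for x
      by (rule codeD[OF X(1) that x0]) (use assms(2) in auto)
    then have "\<forall>x\<in>X. x v = x0 v" by blast
    note c = code_drop_constant[OF X(1) False this]
    have "log q (card ((\<lambda>x. restrict x V) ` X)) \<le> h"
      using assms(1) c(1) X(2) q unfolding UB_def by blast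
    then show "log q (card X) \<le> h"
      using c(2) by (simp add: card_image)
  qed
qed (use assms in \<open>simp add: insert_absorb\<close>)

lemma UB_mono: "UB E V h \<Longrightarrow> h \<le> h' \<Longrightarrow> UB E V h'"
  unfolding UB_def by force

lemma UB_insert:
  assumes "finite V" "UB E V h"
  shows "UB E (insert v V) (h + 1)"
proof (cases "v \<in> V")
  case False
  show ?thesis
    unfolding UB_def
  proof (intro allI impI)
    fix q :: nat and X assume q: "2 \<le> q" and X: "code E (insert v V) q X" "X \<noteq> {}"
    have fin: "finite X" using finite_code[OF _ X(1)] assms(1) by simp
    define Y where "Y = (\<lambda>a. {x\<in>X. x v = a})"
    have bound: "real (card (Y a)) \<le> real q powr h" for a
    proof (cases "Y a = {}")
      case False
      have Y: "code E (insert v V) q (Y a)"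
        using X(1) by (rule code_subset) (auto simp: Y_def)
      have "\<forall>x\<in>Y a. x v = a" by (simp add: Y_def)
      note c = code_drop_constant[OF Y \<open>v \<notin> V\<close> this]
      have "log q (card ((\<lambda>x. restrict x V) ` Y a)) \<le> h"
        using assms(2) c(1) False q unfolding UB_def by blast
      moreover have "card (Y a) > 0"
        using fin False by (auto simp: card_gt_0_iff Y_def)
      ultimately show ?thesis
        using c(2) q by (simp add: card_image log_le_iff)
    qed simp
    have "X \<subseteq> (\<Union>a<q. Y a)"
      using X(1) by (auto simp: code_def Y_def PiE_iff subset_iff)
    then have "card X \<le> card (\<Union>a<q. Y a)"
      using fin by (intro card_mono) (auto simp: Y_def)
    also have "\<dots> \<le> (\<Sum>a<q. card (Y a))"
      by (intro card_UN_le) simp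
    finally have "real (card X) \<le> (\<Sum>a<q. real (card (Y a)))"
      by (metis of_nat_le_iff of_nat_sum)
    also have "\<dots> \<le> (\<Sum>a<q. real q powr h)"
      by (intro sum_mono bound)
    also have "\<dots> = real q powr (h + 1)"
      using q by (simp add: powr_add)
    finally show "log q (card X) \<le> h + 1"
      using q fin X(2) by (simp add: log_le_iff card_gt_0_iff)
  qed
qed (use assms in \<open>auto simp: insert_absorb intro: UB_mono\<close>)

lemma UB_Un:
  assumes "finite V" "finite N" "UB E V h"
  shows "UB E (V \<union> N) (h + card N)"
  using assms(2)
proof induction
  case (insert v N)
  then show ?case
    using UB_insert[of "V \<union> N" E "h + card N" v] assms(1) by (simp add: add_ac)
qed (use assms(3) in simp)

lemma UB_Un_isolated:
  assumes "finite I" "UB E V h" "\<And>u v. v \<in> I \<Longrightarrow> u \<in> V \<union> I \<Longrightarrow> \<not> E u v"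
  shows "UB E (V \<union> I) h"
  using assms(1,3)
proof induction
  case (insert v I)
  then show ?case
    using UB_insert_isolated[of E "V \<union> I" h v] by simp
qed (use assms(2) in simp)

lemma UB_empty: "UB E {} 0"
proof -
  have "card X = 1" if "code E {} q X" "X \<noteq> {}" for q X
    using that by (auto simp: code_def subset_singleton_iff)
  then show ?thesis by (simp add: UB_def)
qed

text \<open>On \<open>I\<close> alone every vertex is isolated and the bound is 0; each of the
  remaining vertices adds at most 1.\<close>

lemma UB_independent:
  assumes "finite V" "I \<subseteq> V" "\<And>u v. u \<in> I \<Longrightarrow> v \<in> I \<Longrightarrow> \<not> E u v"
  shows "UB E V (real (card V) - real (card I))"
proof -
  have fI: "finite I" using assms finite_subset by blast
  have "UB E ({} \<union> I) 0"
    by (rule UB_Un_isolated[OF fI UB_empty]) (use assms(3) in auto)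
  then have "UB E (I \<union> (V - I)) (0 + real (card (V - I)))"
    using assms fI by (intro UB_Un) auto
  moreover have "I \<union> (V - I) = V" using assms by blast
  moreover have "real (card (V - I)) = real (card V) - real (card I)"
    using assms fI by (simp add: card_Diff_subset card_mono of_nat_diff)
  ultimately show ?thesis by simp
qed

definition det :: "('a \<Rightarrow> 'b) set \<Rightarrow> 'a set \<Rightarrow> 'a set \<Rightarrow> bool" where
  "det X S U \<longleftrightarrow> (\<forall>x\<in>X. \<forall>y\<in>X. (\<forall>v\<in>S. x v = y v) \<longrightarrow> (\<forall>v\<in>U. x v = y v))"

section \<open>Shannon inequalities for a fixed code\<close>

locale shannon =
  fixes E :: "'a \<Rightarrow> 'a \<Rightarrow> bool" and V q X
  assumes fin: "finite V" and q: "q \<ge> 2" and X: "code E V q X" "X \<noteq> {}"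
begin

abbreviation h :: "'a set \<Rightarrow> real" where "h \<equiv> proj_entropy (real q) X"

lemma X_fin: "finite X" using finite_code fin X by blast

lemma h_full: "h V = log q (card X)"
  using proj_entropy_full[OF X_fin X(2)] X(1) unfolding code_def by blast

lemma h_empty [simp]: "h {} = 0"
  using proj_entropy_empty X_fin X by blast

lemma submod: "W \<subseteq> S \<Longrightarrow> W \<subseteq> T \<Longrightarrow> det X (S \<union> T) U \<Longrightarrow> h U + h W \<le> h S + h T"
  using q unfolding det_def by (intro proj_entropy_submod[OF X_fin X(2)]) (simp_all, blast)

lemma subadd: "det X (S \<union> T) U \<Longrightarrow> h U \<le> h S + h T"
  using submod[of "{}" S T U] by simp

lemma h_det: "det X S U \<Longrightarrow> h U \<le> h S"
  using subadd[of S "{}" U] by simp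

lemma h_card: "S \<subseteq> V \<Longrightarrow> h S \<le> card S"
proof -
  assume S: "S \<subseteq> V"
  then have "finite S" using fin finite_subset by blast
  then show ?thesis using S
  proof induction
    case (insert v S)
    have "h (insert v S) \<le> h {v} + h S" by (rule subadd) (auto simp: det_def)
    moreover have "h {v} \<le> 1"
      using proj_entropy_single[OF X_fin X(2), of q V v] q X(1) insert.prems by (simp add: code_def)
    ultimately show ?case using insert by simp
  qed simp
qed

lemma h_det_card: "det X S U \<Longrightarrow> S \<subseteq> V \<Longrightarrow> h U \<le> card S"
  using h_det h_card by (meson order_trans)

text \<open>A vertex whose neighbours all lie in \<open>S\<close> is determined by them and joins
  \<open>S\<close> for free. Repeated use closes \<open>S\<close> up step by step.\<close>

lemma det_step:
  assumes "v \<in> V" "\<And>u. u \<in> V \<Longrightarrow> E u v \<Longrightarrow> u \<in> S" "det X (insert v S) U"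
  shows "det X S U"
  unfolding det_def
proof (intro ballI impI)
  fix x y w assume *: "x \<in> X" "y \<in> X" "\<forall>v\<in>S. x v = y v" "w \<in> U"
  have "x v = y v" using codeD[OF X(1) *(1,2) assms(1)] assms(2) *(3) by blast
  then have "\<forall>u\<in>insert v S. x u = y u" using * by blast
  then show "x w = y w" using assms(3) * unfolding det_def by blast
qed

lemma det_subset: "U \<subseteq> S \<Longrightarrow> det X S U"
  unfolding det_def by blast

end

lemma UB_shannonI:
  assumes "finite V"
    and "\<And>q X. shannon E V q X \<Longrightarrow> proj_entropy (real q) X V \<le> h"
  shows "UB E V h"
  unfolding UB_def
proof (intro allI impI)
  fix q :: nat and X assume *: "2 \<le> q" "code E V q X" "X \<noteq> {}"
  then interpret shannon E V q X using assms(1) by unfold_locales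
  show "log q (card X) \<le> h" using assms(2)[of q X] h_full shannon_axioms by simp
qed

section \<open>Upper bounds for the exceptional graphs\<close>

lemma UB_C5:
  assumes V: "V = {a0,a1,a2,a3,a4}" and dist: "distinct [a0,a1,a2,a3,a4]"
    and sym: "\<And>u v. E u v \<Longrightarrow> E v u" and irr: "\<And>v. \<not> E v v"
    and non: "\<not> E a0 a2" "\<not> E a1 a3" "\<not> E a2 a4" "\<not> E a3 a0" "\<not> E a4 a1"
  shows "UB E V (5/2)"
proof (rule UB_shannonI)
  fix q X assume "shannon E V q X"
  then interpret shannon E V q X .
  have non': "\<not> E a2 a0" "\<not> E a3 a1" "\<not> E a4 a2" "\<not> E a0 a3" "\<not> E a1 a4"
    using non sym by blast+
  note D = det_step[unfolded V] and n = non non' irr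
  have d1: "det X {a0,a2} {a0,a1,a2}"
    by (rule D[of a1]) (use n in \<open>auto intro!: det_subset\<close>)
  have d2: "det X {a1,a3} {a1,a2,a3}"
    by (rule D[of a2]) (use n in \<open>auto intro!: det_subset\<close>)
  have d3: "det X {a1,a4} {a0,a1,a4}"
    by (rule D[of a0]) (use n in \<open>auto intro!: det_subset\<close>)
  have d4: "det X ({a0,a1,a2} \<union> {a1,a2,a3}) V" unfolding V
    by (rule D[of a4]) (use n in \<open>auto intro!: det_subset\<close>)
  have d5: "det X ({a1,a2} \<union> {a0,a1,a4}) V" unfolding V
    by (rule D[of a3]) (use n in \<open>auto intro!: det_subset\<close>)
  \<comment> \<open>Adding the two submodular inequalities cancels \<open>h {a1,a2}\<close>, and
    \<open>h {a1}\<close> cancels against the bound for \<open>h {a1,a2,a3}\<close>. What remains is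
    \<open>2 * h V\<close> at most 2 + 1 + 2.\<close>
  have "h {a0,a1,a2} \<le> 2" using h_det_card[OF d1] dist V by simp
  moreover have "h {a1,a2,a3} \<le> h {a1} + h {a3}"
    by (rule subadd) (use d2 in \<open>simp add: insert_commute\<close>)
  moreover have "h {a0,a1,a4} \<le> 2" using h_det_card[OF d3] dist V by simp
  moreover have "h {a3} \<le> 1" using h_card[of "{a3}"] V by simp
  moreover have "h V + h {a1,a2} \<le> h {a0,a1,a2} + h {a1,a2,a3}"
    by (rule submod[OF _ _ d4]) auto
  moreover have "h V + h {a1} \<le> h {a1,a2} + h {a0,a1,a4}"
    by (rule submod[OF _ _ d5]) auto
  ultimately show "h V \<le> 5/2" by linarith
qed (simp add: V)

text \<open>Beyond the 7-cycle only the chords \<open>a0 a3\<close>, \<open>a1 a5\<close> and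
  \<open>a2 a6\<close> are allowed. The bounds 2 + \<open>h {a3,a4}\<close> and 5 -
  \<open>h {a3,a4}\<close> for \<open>h V\<close> add up to 7.\<close>

lemma UB_C7_chords:
  assumes V: "V = {a0,a1,a2,a3,a4,a5,a6}" and dist: "distinct [a0,a1,a2,a3,a4,a5,a6]"
    and sym: "\<And>u v. E u v \<Longrightarrow> E v u" and irr: "\<And>v. \<not> E v v"
    and non: "\<not> E a0 a2" "\<not> E a1 a3" "\<not> E a2 a4" "\<not> E a3 a5" "\<not> E a4 a6" "\<not> E a5 a0" "\<not> E a6 a1"
      "\<not> E a1 a4" "\<not> E a2 a5" "\<not> E a3 a6" "\<not> E a4 a0"
  shows "UB E V (7/2)"
proof (rule UB_shannonI)
  fix q X assume "shannon E V q X"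
  then interpret shannon E V q X .
  have non': "\<not> E a2 a0" "\<not> E a3 a1" "\<not> E a4 a2" "\<not> E a5 a3" "\<not> E a6 a4" "\<not> E a0 a5" "\<not> E a1 a6"
      "\<not> E a4 a1" "\<not> E a5 a2" "\<not> E a6 a3" "\<not> E a0 a4"
    using non sym by blast+
  note D = det_step[unfolded V] and n = non non' irr
  have d1: "det X ({a1} \<union> {a3,a4,a6}) V" unfolding V
    by (rule D[of a0], use n in force, use n in force, rule D[of a2], use n in force, use n in force,
        rule D[of a5]) (use n in \<open>auto intro!: det_subset\<close>)
  have d2: "det X {a0,a2,a4} {a0,a2,a3,a4}"
    by (rule D[of a3]) (use n in \<open>auto intro!: det_subset\<close>)
  have d3: "det X {a3,a5} {a3,a4,a5}"
    by (rule D[of a4]) (use n in \<open>auto intro!: det_subset\<close>)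
  have d4: "det X ({a0,a2,a3,a4} \<union> {a3,a4,a5}) V" unfolding V
    by (rule D[of a1], use n in force, use n in force, rule D[of a6])
      (use n in \<open>auto intro!: det_subset\<close>)
  have "h V \<le> h {a1} + h {a3,a4,a6}" by (rule subadd[OF d1])
  moreover have "h {a1} \<le> 1" using h_card[of "{a1}"] V by simp
  moreover have "h {a3,a4,a6} \<le> h {a3,a4} + h {a6}" by (rule subadd) (auto intro!: det_subset)
  moreover have "h {a6} \<le> 1" using h_card[of "{a6}"] V by simp
  moreover have "h V + h {a3,a4} \<le> h {a0,a2,a3,a4} + h {a3,a4,a5}"
    by (rule submod[OF _ _ d4]) auto
  moreover have "h {a0,a2,a3,a4} \<le> 3" using h_det_card[OF d2] dist V by simp
  moreover have "h {a3,a4,a5} \<le> 2" using h_det_card[OF d3] dist V by simp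
  ultimately show "h V \<le> 7/2" by linarith
qed (simp add: V)

text \<open>The graph consists of the 5-cycle \<open>a0 a1 a2 a3 a4\<close>, the path \<open>a0 w z\<close> and the triangle \<open>z a2 a3\<close>.\<close>

lemma UB_C5_path_triangle:
  assumes V: "V = {a0,a1,a2,a3,a4,w,z}" and dist: "distinct [a0,a1,a2,a3,a4,w,z]"
    and sym: "\<And>u v. E u v \<Longrightarrow> E v u" and irr: "\<And>v. \<not> E v v"
    and non: "\<not> E a0 a2" "\<not> E a1 a3" "\<not> E a2 a4" "\<not> E a3 a0" "\<not> E a4 a1"
      "\<not> E w a1" "\<not> E w a2" "\<not> E w a3" "\<not> E w a4" "\<not> E z a0" "\<not> E z a1" "\<not> E z a4"
  shows "UB E V (11/3)"
proof (rule UB_shannonI)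
  fix q X assume "shannon E V q X"
  then interpret shannon E V q X .
  have non': "\<not> E a2 a0" "\<not> E a3 a1" "\<not> E a4 a2" "\<not> E a0 a3" "\<not> E a1 a4"
      "\<not> E a1 w" "\<not> E a2 w" "\<not> E a3 w" "\<not> E a4 w" "\<not> E a0 z" "\<not> E a1 z" "\<not> E a4 z"
    using non sym by blast+
  note D = det_step[unfolded V] and n = non non' irr
  have d1: "det X {a0,a3} {a0,a3,a4}"
    by (rule D[of a4]) (use n in \<open>auto intro!: det_subset\<close>)
  have d2: "det X ({a0,a1} \<union> {a3,z}) V" unfolding V
    by (rule D[of a2], use n in force, use n in force, rule D[of a4], use n in force, use n in force,
        rule D[of w]) (use n in \<open>auto intro!: det_subset\<close>)
  have d3: "det X ({a2} \<union> {a0,a4,w,z}) V" unfolding V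
    by (rule D[of a1], use n in force, use n in force, rule D[of a3])
      (use n in \<open>auto intro!: det_subset\<close>)
  have d4: "det X ({a0,a4} \<union> {z}) {a0,a4,w,z}"
    by (rule D[of w]) (use n in \<open>auto intro!: det_subset\<close>)
  have d5: "det X ({a0,a1,a2} \<union> {a0,a1,a3,a4,w}) V" unfolding V
    by (rule D[of z]) (use n in \<open>auto intro!: det_subset\<close>)
  have d6: "det X {a0,a2} {a0,a1,a2}"
    by (rule D[of a1]) (use n in \<open>auto intro!: det_subset\<close>)
  have d7: "det X {a1,a4,w} {a0,a1,a4,w}"
    by (rule D[of a0]) (use n in \<open>auto intro!: det_subset\<close>)
  have d8: "det X ({a0,a3,a4} \<union> {a0,a1,a4,w}) {a0,a1,a3,a4,w}" by (auto intro!: det_subset)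
  \<comment> \<open>In the sum of the inequalities the terms \<open>h {a0,a1}\<close>,
    \<open>h {a0,a4}\<close> and \<open>h {a0,a1,a3,a4,w}\<close> cancel, which leaves
    \<open>3 * h V\<close> at most 11.\<close>
  have "h V \<le> h {a0,a1} + h {a3,z}" by (rule subadd[OF d2])
  moreover have "h {a3,z} \<le> 2" using h_card[of "{a3,z}"] V dist by simp
  moreover have "h V \<le> h {a2} + h {a0,a4,w,z}" by (rule subadd[OF d3])
  moreover have "h {a2} \<le> 1" using h_card[of "{a2}"] V by simp
  moreover have "h {a0,a4,w,z} \<le> h {a0,a4} + h {z}" by (rule subadd[OF d4])
  moreover have "h {z} \<le> 1" using h_card[of "{z}"] V by simp
  moreover have "h V + h {a0,a1} \<le> h {a0,a1,a2} + h {a0,a1,a3,a4,w}"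
    by (rule submod[OF _ _ d5]) auto
  moreover have "h {a0,a1,a2} \<le> 2" using h_det_card[OF d6] dist V by simp
  moreover have "h {a0,a1,a3,a4,w} + h {a0,a4} \<le> h {a0,a3,a4} + h {a0,a1,a4,w}"
    by (rule submod[OF _ _ d8]) auto
  moreover have "h {a0,a3,a4} \<le> 2" using h_det_card[OF d1] dist V by simp
  moreover have "h {a0,a1,a4,w} \<le> 3" using h_det_card[OF d7] dist V by simp
  ultimately show "h V \<le> 11/3" by linarith
qed (simp add: V)

subsection \<open>Fractional clique covers and lower bounds\<close>

text \<open>Weights \<open>k/6\<close> suffice for every graph below, so a fractional clique cover of weight \<open>m/6\<close>
  is a list of \<open>m\<close> cliques that covers each vertex six times.\<close>

definition cover :: "('a \<Rightarrow> 'a \<Rightarrow> bool) \<Rightarrow> 'a set \<Rightarrow> nat \<Rightarrow> bool" where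
  "cover E V m \<longleftrightarrow> (\<exists>Cs. length Cs = m \<and> (\<forall>C\<in>set Cs. \<forall>u\<in>C. \<forall>v\<in>C. u \<noteq> v \<longrightarrow> E u v) \<and>
     (\<forall>v\<in>V. 6 \<le> length (filter (\<lambda>C. v \<in> C) Cs)))"

lemma coverI:
  "length Cs = m \<Longrightarrow> (\<And>C u v. C \<in> set Cs \<Longrightarrow> u \<in> C \<Longrightarrow> v \<in> C \<Longrightarrow> u \<noteq> v \<Longrightarrow> E u v) \<Longrightarrow>
    (\<And>v. v \<in> V \<Longrightarrow> 6 \<le> length (filter (\<lambda>C. v \<in> C) Cs)) \<Longrightarrow> cover E V m"
  unfolding cover_def by blast

lemma cover_Un:
  assumes "cover E V m" "cover E W k"
  shows "cover E (V \<union> W) (m + k)"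
proof -
  obtain Cs where Cs: "length Cs = m" "\<forall>C\<in>set Cs. \<forall>u\<in>C. \<forall>v\<in>C. u \<noteq> v \<longrightarrow> E u v"
    "\<forall>v\<in>V. 6 \<le> length (filter (\<lambda>C. v \<in> C) Cs)"
    using assms(1) unfolding cover_def by blast
  obtain Ds where Ds: "length Ds = k" "\<forall>C\<in>set Ds. \<forall>u\<in>C. \<forall>v\<in>C. u \<noteq> v \<longrightarrow> E u v"
    "\<forall>v\<in>W. 6 \<le> length (filter (\<lambda>C. v \<in> C) Ds)"
    using assms(2) unfolding cover_def by blast
  show ?thesis
  proof (rule coverI)
    show "length (Cs @ Ds) = m + k" using Cs Ds by simp
    show "E u v" if "C \<in> set (Cs @ Ds)" "u \<in> C" "v \<in> C" "u \<noteq> v" for C u v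
      using Cs(2) Ds(2) that by (metis Un_iff set_append)
    show "6 \<le> length (filter (\<lambda>C. v \<in> C) (Cs @ Ds))" if "v \<in> V \<union> W" for v
      using that Cs(3) Ds(3) by (fastforce intro: trans_le_add1 trans_le_add2)
  qed
qed

lemma cover_empty: "cover E {} 0"
  by (rule coverI[of "[]"]) auto

lemma cover_clique:
  assumes "\<And>u v. u \<in> V \<Longrightarrow> v \<in> V \<Longrightarrow> u \<noteq> v \<Longrightarrow> E u v"
  shows "cover E V 6"
  by (rule coverI[of "replicate 6 V"]) (use assms in auto)

lemma cover_UN_cliques:
  assumes "finite I" "\<And>i u v. i \<in> I \<Longrightarrow> u \<in> K i \<Longrightarrow> v \<in> K i \<Longrightarrow> u \<noteq> v \<Longrightarrow> E u v"
  shows "cover E (\<Union>i\<in>I. K i) (6 * card I)"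
  using assms
proof induction
  case (insert i I)
  have "cover E (K i \<union> (\<Union>i\<in>I. K i)) (6 + 6 * card I)"
    by (intro cover_Un cover_clique insert) (use insert.prems in auto)
  then show ?case using insert by simp
qed (simp add: cover_empty)

text \<open>Every arc \<open>{v, s v}\<close> is taken three times. A vertex lies on its outgoing
  and its incoming arc, which start at different vertices because \<open>s\<close> has no fixed
  point, so it is covered six times. The two arcs of a transposition are the same edge, counted
  twice.\<close>

lemma cover_of_permutation:
  assumes "finite V" "inj_on s V" "s ` V \<subseteq> V"
    and E: "\<And>v. v \<in> V \<Longrightarrow> E v (s v) \<and> E (s v) v \<and> v \<noteq> s v"
  shows "cover E V (3 * card V)"
proof -
  obtain vs where vs: "set vs = V" "distinct vs"
    using finite_distinct_list[OF assms(1)] by blast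
  let ?Cs = "concat (map (\<lambda>v. replicate 3 {v, s v}) vs)"
  have len: "length (filter P (concat (map (\<lambda>v. replicate 3 (g v)) vs))) = 3 * length (filter (\<lambda>v. P (g v)) vs)"
    for P :: "'a set \<Rightarrow> bool" and g vs
    by (induction vs) auto
  show ?thesis
  proof (rule coverI)
    show "length ?Cs = 3 * card V"
      using len[of "\<lambda>_. True" "\<lambda>v. {v, s v}" vs] distinct_card[OF vs(2)] vs(1) by simp
    show "E u v" if "C \<in> set ?Cs" "u \<in> C" "v \<in> C" "u \<noteq> v" for C u v
    proof -
      obtain w where "w \<in> V" "C = {w, s w}" using \<open>C \<in> set ?Cs\<close> vs(1) by auto
      then show ?thesis using E[of w] that(2-4) by blast
    qed
    show "6 \<le> length (filter (\<lambda>C. v \<in> C) ?Cs)" if v: "v \<in> V" for v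
    proof -
      have "s ` V = V" using endo_inj_surj[OF assms(1,3,2)] .
      then obtain w where w: "w \<in> V" "s w = v" using v by (metis imageE)
      have "card {v, w} \<le> card (set (filter (\<lambda>u. v \<in> {u, s u}) vs))"
        using v w vs by (intro card_mono) auto
      moreover have "card {v, w} = 2" using w E[of w] by auto
      ultimately have "2 \<le> length (filter (\<lambda>u. v \<in> {u, s u}) vs)"
        using card_length le_trans by metis
      then show ?thesis unfolding len by linarith
    qed
  qed
qed

text \<open>Each clique of the cover imposes one parity condition on six-bit symbols. Some choice of the
  \<open>m\<close> parities is satisfied by at least \<open>64 ^ card V / 2 ^ m\<close> configurations, and within such a
  class every bit can be recovered from the other members of its clique.\<close>

lemma code_of_cover:
  assumes fin: "finite V" and "cover E V m"
  obtains X where "code E V 64 X" "64 ^ card V \<le> 2 ^ m * card X"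
proof -
  obtain Cs where Cs: "length Cs = m" "\<forall>C\<in>set Cs. \<forall>u\<in>C. \<forall>v\<in>C. u \<noteq> v \<longrightarrow> E u v"
    "\<forall>v\<in>V. 6 \<le> length (filter (\<lambda>C. v \<in> C) Cs)"
    using assms(2) unfolding cover_def by blast
  \<comment> \<open>At least six positions of the list contain \<open>v\<close>. The injection
    chooses, for each bit \<open>i\<close> of the symbol at \<open>v\<close>, the clique
    \<open>c v i\<close> whose parity involves that bit.\<close>
  have "\<exists>f. f ` {..<6::nat} \<subseteq> {j. j < m \<and> v \<in> Cs ! j} \<and> inj_on f {..<6}" if "v \<in> V" for v
    by (rule card_le_inj) (use Cs that in \<open>auto simp: length_filter_conv_card\<close>)
  then obtain c where c: "\<And>v i. v \<in> V \<Longrightarrow> i < 6 \<Longrightarrow> c v i < m \<and> v \<in> Cs ! c v i"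
    and inj: "\<And>v. v \<in> V \<Longrightarrow> inj_on (c v) {..<6::nat}"
    by (metis (mono_tags, lifting) image_subset_iff lessThan_iff mem_Collect_eq)
  have cE: "E u v" if "u \<in> V" "v \<in> V" "i < 6" "j < 6" "c u i = c v j" "u \<noteq> v" for u v i j
    using Cs(1,2) c[of u i] c[of v j] that by (metis nth_mem)
  \<comment> \<open>A symbol is a six-bit word, given by its set of ones. \<open>D x l\<close>
    collects the ones assigned to clique \<open>l\<close>, and the syndrome \<open>syn x\<close> is
    the set of cliques of odd parity.\<close>
  obtain \<beta> where \<beta>: "bij_betw \<beta> {..<64::nat} (Pow {..<6::nat})"
    using finite_same_card_bij[of "{..<64::nat}" "Pow {..<6::nat}"] by (auto simp: card_Pow)
  define A where "A = PiE V (\<lambda>_. {..<64::nat})"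
  define D where "D = (\<lambda>x l. {(v, i). v \<in> V \<and> i < 6 \<and> i \<in> \<beta> (x v) \<and> c v i = l})"
  define syn where "syn = (\<lambda>x. {l. l < m \<and> odd (card (D x l))})"
  have finD: "finite (D x l)" for x l
    by (rule finite_subset[of _ "V \<times> {..<6}"]) (use fin in \<open>auto simp: D_def\<close>)
  have finA: "finite A" using fin by (auto simp: A_def intro: finite_PiE)
  have cardA: "card A = 64 ^ card V" using fin by (simp add: A_def card_PiE)
  \<comment> \<open>Pigeonhole: there are only \<open>2 ^ m\<close> possible syndromes.\<close>
  have "\<exists>s\<in>Pow {..<m}. 64 ^ card V \<le> 2 ^ m * card {x\<in>A. syn x = s}"
  proof (rule ccontr)
    assume "\<not> ?thesis"
    then have "(\<Sum>s\<in>Pow {..<m}. 2 ^ m * card {x\<in>A. syn x = s}) < (\<Sum>s\<in>Pow {..<m}. 64 ^ card V)"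
      by (intro sum_strict_mono) (auto simp: not_le)
    also have "\<dots> = 2 ^ m * card A" by (simp add: cardA card_Pow)
    finally have "(\<Sum>s\<in>Pow {..<m}. card {x\<in>A. syn x = s}) < card A"
      unfolding sum_distrib_left[symmetric] by simp
    moreover have "card A \<le> card (\<Union>s\<in>Pow {..<m}. {x\<in>A. syn x = s})"
    proof (rule card_mono)
      show "finite (\<Union>s\<in>Pow {..<m}. {x\<in>A. syn x = s})"
        using finA by (intro finite_UN_I) auto
      have "syn x \<in> Pow {..<m}" for x by (auto simp: syn_def)
      then show "A \<subseteq> (\<Union>s\<in>Pow {..<m}. {x\<in>A. syn x = s})" by blast
    qed
    moreover have "\<dots> \<le> (\<Sum>s\<in>Pow {..<m}. card {x\<in>A. syn x = s})"
      by (intro card_UN_le) simp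
    ultimately show False by linarith
  qed
  then obtain s where s: "64 ^ card V \<le> 2 ^ m * card {x\<in>A. syn x = s}" by blast
  have "code E V 64 {x\<in>A. syn x = s}"
    unfolding code_def
  proof (intro conjI ballI impI)
    fix x y v assume x: "x \<in> {x\<in>A. syn x = s}" and y: "y \<in> {x\<in>A. syn x = s}" and v: "v \<in> V"
      and nb: "\<forall>u\<in>V. E u v \<longrightarrow> x u = y u"
    have mem: "x v < 64" "y v < 64" using x y v by (auto simp: A_def PiE_iff)
    have "i \<in> \<beta> (x v) \<longleftrightarrow> i \<in> \<beta> (y v)" if i: "i < 6" for i
    proof -
      let ?l = "c v i"
      have l: "?l < m" using c v i by blast
      \<comment> \<open>The six bits of one vertex go to different cliques, so all other bits of
        clique \<open>?l\<close> belong to neighbours of \<open>v\<close>, where \<open>x\<close>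
        and \<open>y\<close> agree.\<close>
      have "u \<noteq> v" if "(u, j) \<noteq> (v, i)" "u \<in> V" "j < 6" "c u j = ?l" for u j
        using inj[OF v] that i by (auto dest: inj_onD)
      then have eq: "x u = y u" if "(u, j) \<noteq> (v, i)" "u \<in> V" "j < 6" "c u j = ?l" for u j
        using nb cE[of u v j i] that v i by blast
      then have R: "D x ?l - {(v, i)} = D y ?l - {(v, i)}"
        unfolding D_def by force
      have card: "card (D x ?l) = card (D x ?l - {(v, i)}) + (if i \<in> \<beta> (x v) then 1 else 0)" for x
      proof (cases "i \<in> \<beta> (x v)")
        case True
        then have "(v, i) \<in> D x ?l" using v i by (simp add: D_def)
        then show ?thesis using True finD[of x ?l] card.remove by fastforce
      next
        case False
        then have "(v, i) \<notin> D x ?l" by (simp add: D_def)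
        then show ?thesis using False by simp
      qed
      have "?l \<in> syn x \<longleftrightarrow> ?l \<in> syn y" using x y by simp
      then have "odd (card (D x ?l)) \<longleftrightarrow> odd (card (D y ?l))" using l by (simp add: syn_def)
      then show ?thesis using card[of x] card[of y] R by (auto split: if_splits)
    qed
    moreover have "\<beta> (x v) \<subseteq> {..<6}" "\<beta> (y v) \<subseteq> {..<6}"
      using bij_betwE[OF \<beta>] mem by auto
    ultimately have "\<beta> (x v) = \<beta> (y v)" by blast
    then show "x v = y v"
      using \<beta> mem by (auto simp: bij_betw_def dest: inj_onD)
  qed (auto simp: A_def)
  then show ?thesis using s that by blast
qed

subsection \<open>Hall's theorem\<close>

text \<open>Induction on \<open>card A\<close>. If every nonempty proper subset has a surplus of
  neighbours, any one element is matched and its partner removed without violating the condition.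
  Otherwise some proper subset is tight, and it is matched separately from its complement, whose
  elements avoid the neighbours used up.\<close>

lemma hall:
  fixes N :: "'a \<Rightarrow> 'b set"
  assumes "finite A" "\<And>a. a \<in> A \<Longrightarrow> finite (N a)"
    and "\<And>S. S \<subseteq> A \<Longrightarrow> card S \<le> card (\<Union>(N ` S))"
  shows "\<exists>f. inj_on f A \<and> (\<forall>a\<in>A. f a \<in> N a)"
  using assms
proof (induction "card A" arbitrary: A N rule: less_induct)
  case less
  note hall = less.prems(3)
  have finU: "finite (\<Union>(N ` S))" if "S \<subseteq> A" for S
    using that less.prems(1,2) by (meson finite_UN finite_subset subsetD)
  show ?case
  proof (cases "A = {}")
    case False
    then obtain a where a: "a \<in> A" by blast
    show ?thesis
    proof (cases "\<forall>S\<subseteq>A. S \<noteq> {} \<longrightarrow> S \<noteq> A \<longrightarrow> card S < card (\<Union>(N ` S))")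
      case True
      have "N a \<noteq> {}" using hall[of "{a}"] a by auto
      then obtain b where b: "b \<in> N a" by blast
      have "\<exists>f. inj_on f (A - {a}) \<and> (\<forall>x\<in>A - {a}. f x \<in> N x - {b})"
      proof (rule less.hyps)
        show "card (A - {a}) < card A" using a less.prems(1) by (intro psubset_card_mono) auto
        show "finite (A - {a})" using less.prems(1) by simp
        show "finite (N x - {b})" if "x \<in> A - {a}" for x using less.prems(2) that by simp
        show "card S \<le> card (\<Union>x\<in>S. N x - {b})" if S: "S \<subseteq> A - {a}" for S
        proof (cases "S = {}")
          case False
          then have "card S < card (\<Union>(N ` S))" using True S a by blast
          moreover have "(\<Union>x\<in>S. N x - {b}) = \<Union>(N ` S) - {b}" by blast
          moreover have "card (\<Union>(N ` S)) - 1 \<le> card (\<Union>(N ` S) - {b})"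
            using diff_card_le_card_Diff[of "{b}"] by simp
          ultimately show ?thesis by simp
        qed simp
      qed
      then obtain f where f: "inj_on f (A - {a})" "\<And>x. x \<in> A - {a} \<Longrightarrow> f x \<in> N x - {b}" by blast
      have "inj_on (f(a := b)) A"
        using f unfolding inj_on_def by (auto; metis DiffD2 DiffI singletonD singletonI)
      then show ?thesis using f b by (intro exI[of _ "f(a := b)"]) auto
    next
      case False
      then obtain S where S: "S \<subseteq> A" "S \<noteq> {}" "S \<noteq> A" and "\<not> card S < card (\<Union>(N ` S))" by blast
      then have tight: "card (\<Union>(N ` S)) = card S" using hall[of S] by simp
      have finS: "finite S" using S less.prems(1) finite_subset by blast
      let ?U = "\<Union>(N ` S)"
      have "\<exists>f. inj_on f S \<and> (\<forall>x\<in>S. f x \<in> N x)"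
      proof (rule less.hyps)
        show "card S < card A" using S less.prems(1) by (intro psubset_card_mono) auto
      qed (use S less.prems finS in auto)
      then obtain f where f: "inj_on f S" "\<And>x. x \<in> S \<Longrightarrow> f x \<in> N x" by blast
      have "\<exists>g. inj_on g (A - S) \<and> (\<forall>x\<in>A - S. g x \<in> N x - ?U)"
      proof (rule less.hyps)
        show "card (A - S) < card A" using S less.prems(1) by (intro psubset_card_mono) auto
        show "card T \<le> card (\<Union>x\<in>T. N x - ?U)" if T: "T \<subseteq> A - S" for T
        proof -
          have finT: "finite T" using T less.prems(1) finite_subset by blast
          have "card T + card S = card (T \<union> S)"
            using T finS finT by (intro card_Un_disjoint[symmetric]) auto
          also have "\<dots> \<le> card (\<Union>(N ` (T \<union> S)))" using T S by (intro hall) auto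
          also have "\<Union>(N ` (T \<union> S)) = (\<Union>x\<in>T. N x - ?U) \<union> ?U" by blast
          also have "card \<dots> \<le> card (\<Union>x\<in>T. N x - ?U) + card ?U" by (rule card_Un_le)
          finally show ?thesis using tight by simp
        qed
      qed (use less.prems in auto)
      then obtain g where g: "inj_on g (A - S)" "\<And>x. x \<in> A - S \<Longrightarrow> g x \<in> N x - ?U" by blast
      let ?h = "\<lambda>x. if x \<in> S then f x else g x"
      have "inj_on ?h A"
      proof (rule inj_onI)
        fix x y assume *: "x \<in> A" "y \<in> A" "?h x = ?h y"
        have "f u \<noteq> g v" if "u \<in> S" "v \<in> A - S" for u v
          using f(2)[OF that(1)] g(2)[OF that(2)] that by auto
        then show "x = y"
          using * f(1) g(1) unfolding inj_on_def by (metis DiffI)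
      qed
      then show ?thesis using f(2) g(2) by (intro exI[of _ ?h]) auto
    qed
  qed simp
qed

subsection \<open>Entropy in terms of codes\<close>

text \<open>Essential dependence concerns one coordinate at a time, so the coordinates in
  \<open>W\<close> are changed one after the other.\<close>

lemma IG_subD:
  assumes IG: "IG_sub n q f E" and v: "v < n" and "finite W" "\<And>w. w \<in> W \<Longrightarrow> w < n \<and> \<not> E w v"
    and ab: "a \<in> configs n q" "b \<in> configs n q" "\<And>w. w < n \<Longrightarrow> w \<notin> W \<Longrightarrow> a w = b w"
  shows "f a v = f b v"
  using assms(3,4) ab
proof (induction W arbitrary: b)
  case empty
  then have "a = b" unfolding configs_def by (intro PiE_ext[of a "{..<n}" _ b]) auto
  then show ?case by simp
next
  case (insert w W)
  let ?c = "b(w := a w)"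
  have w: "w < n" "\<not> E w v" using insert.prems(1) by auto
  then have c: "?c \<in> configs n q"
    using insert.prems(2,3) unfolding configs_def by (auto simp: PiE_iff extensional_def)
  have "f a v = f ?c v"
  proof (rule insert.IH)
    show "u < n \<and> \<not> E u v" if "u \<in> W" for u using insert.prems(1) that by blast
    show "a u = ?c u" if "u < n" "u \<notin> W" for u using insert.prems(4)[of u] that by auto
  qed (fact insert.prems(2), fact c)
  also have "\<not> depends n q f w v" using IG v w unfolding IG_sub_def by blast
  then have "f ?c v = f b v"
    using c insert.prems(3) unfolding depends_def by fastforce
  finally show ?case .
qed

lemma code_Fix:
  assumes "IG_sub n q f E"
  shows "code E {..<n} q (Fix n q f)"
  unfolding code_def
proof (intro conjI ballI impI)
  show "Fix n q f \<subseteq> PiE {..<n} (\<lambda>_. {..<q})" by (auto simp: Fix_def configs_def)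
  fix x y v assume *: "x \<in> Fix n q f" "y \<in> Fix n q f" "v \<in> {..<n}" "\<forall>u\<in>{..<n}. E u v \<longrightarrow> x u = y u"
  have "f x v = f y v"
    by (rule IG_subD[OF assms, of v "{w. w < n \<and> \<not> E w v}"]) (use * in \<open>auto simp: Fix_def\<close>)
  then show "x v = y v" using * by (simp add: Fix_def)
qed

text \<open>Coordinate \<open>v\<close> looks for a codeword that agrees with \<open>x\<close> on
  the neighbours of \<open>v\<close> and copies its entry at \<open>v\<close>. For \<open>x\<close>
  in \<open>X\<close> the code property forces this entry to be \<open>x v\<close>.\<close>

lemma Fix_of_code:
  assumes X: "code E {..<n} q X" and q: "q > 0"
  obtains f where "\<forall>x\<in>configs n q. f x \<in> configs n q" "IG_sub n q f E" "X \<subseteq> Fix n q f"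
proof -
  define P where "P = (\<lambda>x v y. y \<in> X \<and> (\<forall>u<n. E u v \<longrightarrow> y u = x u))"
  \<comment> \<open>The default 0 is a legal symbol because \<open>q > 0\<close>.\<close>
  define f where "f = (\<lambda>x. \<lambda>v\<in>{..<n}. if \<exists>y. P x v y then (SOME y. P x v y) v else 0)"
  have Xc: "X \<subseteq> configs n q" using X by (simp add: code_def configs_def)
  have SP: "P x v (SOME y. P x v y)" if "\<exists>y. P x v y" for x v using someI_ex[OF that] .
  have "f x v < q" if "v < n" for x v
  proof (cases "\<exists>y. P x v y")
    case True
    then have "(SOME y. P x v y) \<in> configs n q" using SP[of x v] Xc unfolding P_def by blast
    then show ?thesis using True that by (auto simp: f_def configs_def PiE_iff)
  qed (use q that in \<open>auto simp: f_def\<close>)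
  then have 1: "\<forall>x\<in>configs n q. f x \<in> configs n q"
    by (auto simp: configs_def PiE_iff f_def)
  have "f a v = f b v" if v: "v < n" "\<not> E u v" and ab: "\<forall>w<n. w \<noteq> u \<longrightarrow> a w = b w" for a b u v
  proof -
    have "P a v = P b v" unfolding P_def using v ab by (intro ext) metis
    then show ?thesis by (auto simp: f_def)
  qed
  then have 2: "IG_sub n q f E" unfolding IG_sub_def depends_def by blast
  have "f x = x" if x: "x \<in> X" for x
  proof
    fix v
    show "f x v = x v"
    proof (cases "v < n")
      case True
      have ex: "\<exists>y. P x v y" using x unfolding P_def by blast
      have "(SOME y. P x v y) v = x v"
        by (rule codeD[OF X _ x]) (use SP[OF ex] True in \<open>auto simp: P_def\<close>)
      then show ?thesis using ex True by (simp add: f_def)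
    next
      case False
      then show ?thesis using x Xc by (auto simp: f_def configs_def PiE_iff extensional_def)
    qed
  qed
  then have 3: "X \<subseteq> Fix n q f" using Xc by (auto simp: Fix_def)
  show ?thesis using that[OF 1 2 3] .
qed

lemma finite_configs: "finite (configs n q)"
  by (simp add: configs_def finite_PiE)

text \<open>This makes the \<open>Max\<close> in \<open>guessing_number\<close> meaningful: every
  candidate is the logarithm of a number at most \<open>card (configs n q)\<close>, and the empty
  code supplies one candidate.\<close>

lemma guessing_number_candidates:
  defines "L \<equiv> \<lambda>n E q. {log (real q) (real (card (Fix n q f))) | f.
      (\<forall>x\<in>configs n q. f x \<in> configs n q) \<and> IG_sub n q f E}"
  shows "finite (L n E q)" "q > 0 \<Longrightarrow> L n E q \<noteq> {}"
proof -
  have "card (Fix n q f) \<le> card (configs n q)" for f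
    by (rule card_mono[OF finite_configs]) (auto simp: Fix_def)
  then have "L n E q \<subseteq> (\<lambda>k. log (real q) (real k)) ` {..card (configs n q)}"
    unfolding L_def by auto
  then show "finite (L n E q)" by (rule finite_subset) simp
  assume "q > 0"
  moreover have "code E {..<n} q {}" by (simp add: code_def)
  ultimately obtain f where "\<forall>x\<in>configs n q. f x \<in> configs n q" "IG_sub n q f E"
    using Fix_of_code by metis
  then show "L n E q \<noteq> {}" unfolding L_def by blast
qed

lemma guessing_number_le:
  assumes "UB E {..<n} h" "h \<ge> 0" "q \<ge> 2"
  shows "guessing_number n E q \<le> h"
proof -
  have "log q (card (Fix n q f)) \<le> h" if "IG_sub n q f E" for f
  proof (cases "Fix n q f = {}")
    case False
    then show ?thesis using assms code_Fix[OF that] unfolding UB_def by blast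
  \<comment> \<open>Without fixed points the candidate is \<open>log q 0\<close>, which is 0 by
    convention; hence the requirement \<open>h \<ge> 0\<close>.\<close>
  qed (use assms(2) in \<open>simp add: log_def\<close>)
  moreover have "guessing_number n E q \<in> {log (real q) (real (card (Fix n q f))) | f.
      (\<forall>x\<in>configs n q. f x \<in> configs n q) \<and> IG_sub n q f E}"
    unfolding guessing_number_def using assms(3) by (intro Max_in guessing_number_candidates) auto
  ultimately show ?thesis by auto
qed

lemma guessing_number_ge:
  assumes "code E {..<n} q X" "X \<noteq> {}" "q \<ge> 2"
  shows "log q (card X) \<le> guessing_number n E q"
proof -
  obtain f where f: "\<forall>x\<in>configs n q. f x \<in> configs n q" "IG_sub n q f E" "X \<subseteq> Fix n q f"
    using Fix_of_code[OF assms(1)] assms(3) by auto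
  have fin: "finite (Fix n q f)"
    by (rule finite_subset[OF _ finite_configs]) (auto simp: Fix_def)
  have "0 < card X" using finite_subset[OF f(3) fin] assms(2) by (simp add: card_gt_0_iff)
  moreover have "card X \<le> card (Fix n q f)" by (rule card_mono[OF fin f(3)])
  ultimately have "log q (card X) \<le> log q (card (Fix n q f))" using assms(3) by simp
  also have "\<dots> \<le> guessing_number n E q"
    unfolding guessing_number_def using f by (intro Max_ge guessing_number_candidates) auto
  finally show ?thesis .
qed

lemma entropy_le:
  assumes "UB E {..<n} h" "h \<ge> 0"
  shows "entropy n E \<le> h"
  unfolding entropy_def by (rule cSUP_least) (use guessing_number_le[OF assms] in auto)

text \<open>The alphabet of size 64 already attains the bound: a parity condition costs one bit, and
  \<open>log 64 2\<close> is 1/6.\<close>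

lemma entropy_ge:
  assumes "cover E {..<n} m"
  shows "real n - real m / 6 \<le> entropy n E"
proof -
  obtain X where X: "code E {..<n} 64 X" "64 ^ n \<le> 2 ^ m * card X"
    using code_of_cover[OF _ assms] by auto
  have c: "card X > 0" using X(2) by (cases "card X = 0") auto
  have "real (64 ^ n) \<le> real (2 ^ m * card X)" using X(2) of_nat_le_iff by blast
  then have "64 ^ n \<le> 2 ^ m * real (card X)" by simp
  then have "log 64 (64 ^ n) \<le> log 64 (2 ^ m * real (card X))" by (intro log_mono) auto
  also have "\<dots> = real m * log 64 2 + log 64 (card X)"
    using c by (simp add: log_mult log_nat_power)
  also have "log 64 2 = (1/6::real)"
  proof -
    have "log 64 (2 ^ 6) = (1::real)" by simp
    then have "6 * log 64 2 = (1::real)" by (subst (asm) log_nat_power) auto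
    then show ?thesis by simp
  qed
  finally have "real n - real m / 6 \<le> log 64 (card X)" by (simp add: log_nat_power)
  also have "\<dots> \<le> guessing_number n E 64"
    using guessing_number_ge[OF X(1)] c by fastforce
  also have "\<dots> \<le> entropy n E"
    unfolding entropy_def
  proof (rule cSUP_upper)
    \<comment> \<open>The trivial bound by the number of vertices, needed for the supremum to be an
      upper bound.\<close>
    have "UB E {..<n} (real n - 0)"
      using UB_independent[of "{..<n}" "{}" E] by simp
    then show "bdd_above (guessing_number n E ` {2..})"
      by (intro bdd_aboveI2[of _ _ "real n"] guessing_number_le) auto
  qed simp
  finally show ?thesis .
qed

lemma entropy_eqI:
  assumes "UB E {..<n} h" "cover E {..<n} m" "real n - real m / 6 = h" "h \<ge> 0"
  shows "entropy n E = h"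
  using entropy_le[OF assms(1,4)] entropy_ge[OF assms(2)] assms(3) by simp

subsection \<open>Cycle decompositions\<close>

text \<open>The orbit of \<open>x\<close> under an injective self-map of a finite set is a pure
  cycle, and by injectivity nothing outside maps into it.\<close>

lemma closed_walk_split:
  assumes fin: "finite V" and x: "x \<in> V" and inj: "inj_on s V" and sV: "s ` V \<subseteq> V"
  obtains xs where "distinct xs" "xs \<noteq> []" "set xs \<subseteq> V"
    "\<And>i. i < length xs \<Longrightarrow> s (xs ! i) = xs ! (Suc i mod length xs)"
    "s ` (V - set xs) \<subseteq> V - set xs"
proof -
  define g where "g = (\<lambda>i. (s ^^ i) x)"
  have gV: "g i \<in> V" for i by (induction i) (use x sV in \<open>auto simp: g_def\<close>)
  have gS: "g (Suc i) = s (g i)" for i by (simp add: g_def)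
  have "\<not> inj g"
    using finite_imageD[of g UNIV] finite_subset[OF _ fin, of "range g"] gV by auto
  then obtain i j where "i < j" "g i = g j"
    by (metis injI nat_neq_iff)
  \<comment> \<open>Cancelling \<open>s\<close> on both sides \<open>i\<close> times moves a
    repetition back to the starting point.\<close>
  have shift: "g (j - i) = x" if "i < j" "g i = g j" for i j
    using that
  proof (induction i arbitrary: j)
    case (Suc i)
    then obtain j' where j: "j = Suc j'" "i < j'" by (cases j) auto
    then have "g i = g j'" using Suc.prems(2) gS gV inj by (metis inj_onD)
    then show ?case using Suc.IH j by simp
  qed (simp add: g_def)
  define k where "k = (LEAST k. k > 0 \<and> g k = x)"
  have k: "k > 0 \<and> g k = x"
    unfolding k_def using shift[OF \<open>i < j\<close> \<open>g i = g j\<close>] \<open>i < j\<close>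
    by (intro LeastI[where P = "\<lambda>k. k > 0 \<and> g k = x" and k = "j - i"]) simp
  have least: "l \<ge> k" if "l > 0" "g l = x" for l
    unfolding k_def using that by (intro Least_le) simp
  define xs where "xs = map g [0..<k]"
  have nth: "xs ! i = g i" if "i < k" for i using that by (simp add: xs_def)
  have len: "length xs = k" by (simp add: xs_def)
  have "g i \<noteq> g j" if "i < j" "j < k" for i j
    using shift[OF that(1)] least[of "j - i"] that by linarith
  then have "distinct xs"
    unfolding distinct_conv_nth len by (metis nat_neq_iff nth)
  moreover have "xs \<noteq> []" using k len by auto
  moreover have "set xs \<subseteq> V" using gV by (auto simp: xs_def)
  moreover have step: "s (xs ! i) = xs ! (Suc i mod length xs)" if "i < length xs" for i
  proof (cases "Suc i = k")
    case True
    then have "s (xs ! i) = x" using k nth[of i] gS[of i] by simp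
    then show ?thesis using True len k nth[of 0] by (simp add: g_def)
  next
    case False
    then show ?thesis using that len nth[of i] nth[of "Suc i"] gS[of i] by simp
  qed
  moreover have "s ` (V - set xs) \<subseteq> V - set xs"
  proof (clarify, intro conjI DiffI)
    fix y assume y: "y \<in> V" "y \<notin> set xs"
    show "s y \<in> V" using y sV by blast
    show "s y \<notin> set xs"
    proof
      \<comment> \<open>The image already has a preimage on the cycle, and injectivity identifies it
        with \<open>y\<close>.\<close>
      assume "s y \<in> set xs"
      then obtain i where i: "i < k" "s y = g i" using nth len by (metis in_set_conv_nth)
      obtain j where j: "j < k" "s (g j) = g i"
      proof (cases i)
        case 0
        then show ?thesis using that[of "k - 1"] k gS[of "k - 1"] by (auto simp: g_def)
      next
        case (Suc l)
        then show ?thesis using that[of l] i gS[of l] by auto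
      qed
      then have "y = g j" using i(2) y(1) gV inj by (metis inj_onD)
      then show False using y(2) j(1) nth len by (metis nth_mem)
    qed
  qed
  ultimately show ?thesis using that by blast
qed

locale ugraph =
  fixes E :: "'a \<Rightarrow> 'a \<Rightarrow> bool"
  assumes sym: "E u v \<Longrightarrow> E v u" and irr: "\<not> E v v"
begin

definition edge_perm :: "('a \<Rightarrow> 'a) \<Rightarrow> 'a set \<Rightarrow> bool" where
  "edge_perm s V \<longleftrightarrow> finite V \<and> inj_on s V \<and> s ` V \<subseteq> V \<and> (\<forall>v\<in>V. E v (s v))"

text \<open>Lists of length two count as cycles: a transposition is an edge traversed in both
  directions.\<close>

definition cycle :: "'a list \<Rightarrow> bool" where
  "cycle xs \<longleftrightarrow> distinct xs \<and> successively E xs \<and> E (last xs) (hd xs)"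

lemma edge_perm_split:
  assumes "edge_perm s V" "V \<noteq> {}"
  obtains xs where "cycle xs" "2 \<le> length xs" "length xs \<le> card V" "set xs \<subseteq> V"
    "edge_perm s (V - set xs)" "card (V - set xs) = card V - length xs"
proof -
  obtain x where x: "x \<in> V" using assms(2) by blast
  have s: "finite V" "inj_on s V" "s ` V \<subseteq> V" "\<And>v. v \<in> V \<Longrightarrow> E v (s v)"
    using assms(1) by (auto simp: edge_perm_def)
  obtain xs where xs: "distinct xs" "xs \<noteq> []" "set xs \<subseteq> V"
    "\<And>i. i < length xs \<Longrightarrow> s (xs ! i) = xs ! (Suc i mod length xs)"
    "s ` (V - set xs) \<subseteq> V - set xs"
    using closed_walk_split[OF s(1) x s(2,3)] by blast
  have E: "E (xs ! i) (xs ! (Suc i mod length xs))" if "i < length xs" for i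
    using s(4)[of "xs ! i"] xs(4)[OF that] xs(3) that by (metis nth_mem subsetD)
  have "length xs \<noteq> 1" using E[of 0] irr xs(2) by auto
  moreover have "length xs \<noteq> 0" using xs(2) by simp
  ultimately have "2 \<le> length xs" by linarith
  moreover have "edge_perm s (V - set xs)"
    unfolding edge_perm_def using s xs(5) by (auto intro: inj_on_diff)
  moreover have "card (V - set xs) = card V - length xs"
    using s(1) xs(3) by (simp add: card_Diff_subset distinct_card[OF xs(1)])
  moreover have "length xs \<le> card V"
    using card_mono[OF s(1) xs(3)] distinct_card[OF xs(1)] by simp
  moreover have "cycle xs"
    unfolding cycle_def successively_conv_nth
  proof (intro conjI allI impI)
    show "E (xs ! i) (xs ! Suc i)" if "Suc i < length xs" for i
      using E[of i] that by simp
    show "E (last xs) (hd xs)"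
      using E[of "length xs - 1"] xs(2) by (simp add: last_conv_nth hd_conv_nth)
  qed (fact xs(1))
  ultimately show ?thesis using that xs(3) by blast
qed

lemma cycle2: "cycle xs \<Longrightarrow> length xs = 2 \<Longrightarrow> \<exists>a b. xs = [a,b] \<and> E a b"
  by (auto simp: cycle_def length_Suc_conv eval_nat_numeral)

lemma cycle3: "cycle xs \<Longrightarrow> length xs = 3 \<Longrightarrow> \<exists>a b c. xs = [a,b,c] \<and> E a b \<and> E b c \<and> E c a"
  by (auto simp: cycle_def length_Suc_conv eval_nat_numeral)

lemma cycle4:
  "cycle xs \<Longrightarrow> length xs = 4 \<Longrightarrow> \<exists>a b c d. xs = [a,b,c,d] \<and> E a b \<and> E b c \<and> E c d \<and> E d a"
  by (auto simp: cycle_def length_Suc_conv eval_nat_numeral)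

lemma cycle5:
  "cycle xs \<Longrightarrow> length xs = 5 \<Longrightarrow>
    \<exists>a b c d e. xs = [a,b,c,d,e] \<and> E a b \<and> E b c \<and> E c d \<and> E d e \<and> E e a"
  by (auto simp: cycle_def length_Suc_conv eval_nat_numeral)

lemma cycle7:
  "cycle xs \<Longrightarrow> length xs = 7 \<Longrightarrow>
    \<exists>a b c d e f g. xs = [a,b,c,d,e,f,g] \<and> E a b \<and> E b c \<and> E c d \<and> E d e \<and> E e f \<and> E f g \<and> E g a"
  by (auto simp: cycle_def length_Suc_conv eval_nat_numeral)

lemma cycle_distinct: "cycle xs \<Longrightarrow> distinct xs"
  by (simp add: cycle_def)

lemma edge_perm_card2:
  assumes "edge_perm s V" "card V = 2"
  obtains a b where "V = {a,b}" "a \<noteq> b" "E a b"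
proof -
  have fin: "finite V" using assms by (simp add: edge_perm_def)
  obtain xs where xs: "cycle xs" "2 \<le> length xs" "length xs \<le> card V" "set xs \<subseteq> V"
    using edge_perm_split[OF assms(1)] assms(2) by (metis card.empty zero_neq_numeral)
  then obtain a b where ab: "xs = [a,b]" "E a b" using cycle2[of xs] assms(2) by auto
  then have "{a,b} = V" using xs cycle_distinct[OF xs(1)] assms(2) fin
    by (intro card_subset_eq) auto
  then show ?thesis using that ab irr by blast
qed

lemma edge_perm_card_neq_1: "edge_perm s V \<Longrightarrow> card V \<noteq> 1"
  by (auto simp: edge_perm_def card_1_singleton_iff irr)

lemma edge_perm_card3:
  assumes "edge_perm s V" "card V = 3"
  obtains a b c where "V = {a,b,c}" "distinct [a,b,c]" "E a b" "E b c" "E c a"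
proof -
  have fin: "finite V" using assms by (simp add: edge_perm_def)
  obtain xs where xs: "cycle xs" "2 \<le> length xs" "length xs \<le> card V" "set xs \<subseteq> V"
    "edge_perm s (V - set xs)" "card (V - set xs) = card V - length xs"
    using edge_perm_split[OF assms(1)] assms(2) by (metis card.empty zero_neq_numeral)
  have "length xs \<noteq> 2" using edge_perm_card_neq_1[OF xs(5)] xs(6) assms(2) by auto
  then obtain a b c where abc: "xs = [a,b,c]" "E a b" "E b c" "E c a"
    using cycle3[of xs] xs(1-3) assms(2) by auto
  then have "{a,b,c} = V" using xs cycle_distinct[OF xs(1)] assms(2) fin
    by (intro card_subset_eq) auto
  then show ?thesis using that[of a b c] abc cycle_distinct[OF xs(1)] by auto
qed

text \<open>A 4-cycle contains two disjoint edges, so both cycle types give the same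
  conclusion.\<close>

lemma edge_perm_card4:
  assumes "edge_perm s V" "card V = 4"
  obtains a b c d where "V = {a,b,c,d}" "distinct [a,b,c,d]" "E a b" "E c d"
proof -
  have fin: "finite V" using assms by (simp add: edge_perm_def)
  obtain xs where xs: "cycle xs" "2 \<le> length xs" "length xs \<le> card V" "set xs \<subseteq> V"
    "edge_perm s (V - set xs)" "card (V - set xs) = card V - length xs"
    using edge_perm_split[OF assms(1)] assms(2) by (metis card.empty zero_neq_numeral)
  have "length xs \<noteq> 3" using edge_perm_card_neq_1[OF xs(5)] xs(6) assms(2) by auto
  then consider "length xs = 2" | "length xs = 4" using xs assms(2) by linarith
  then show ?thesis
  proof cases
    case 1
    then obtain a b where ab: "xs = [a,b]" "E a b" using cycle2 xs(1) by blast
    obtain c d where cd: "V - set xs = {c,d}" "c \<noteq> d" "E c d"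
      by (rule edge_perm_card2[OF xs(5)]) (use xs(6) assms(2) 1 in simp_all)
    have "V = {a,b,c,d}" using cd(1) ab(1) xs(4) by auto
    moreover have "distinct [a,b,c,d]" using cd cycle_distinct[OF xs(1)] ab by auto
    ultimately show ?thesis using that ab cd by blast
  next
    case 2
    then obtain a b c d where abc: "xs = [a,b,c,d]" "E a b" "E c d" using cycle4 xs(1) by blast
    then have "{a,b,c,d} = V" using xs cycle_distinct[OF xs(1)] assms(2) fin
      by (intro card_subset_eq) auto
    then show ?thesis using that[of a b c d] abc cycle_distinct[OF xs(1)] by auto
  qed
qed

lemma edge_perm_card5:
  assumes "edge_perm s V" "card V = 5"
  obtains
    (cycle) a b c d e where "V = {a,b,c,d,e}" "distinct [a,b,c,d,e]" "E a b" "E b c" "E c d" "E d e" "E e a"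
  | (triangle) a b c d e where "V = {a,b,c,d,e}" "distinct [a,b,c,d,e]" "E a b" "E b c" "E c a" "E d e"
proof -
  have fin: "finite V" using assms by (simp add: edge_perm_def)
  obtain xs where xs: "cycle xs" "2 \<le> length xs" "length xs \<le> card V" "set xs \<subseteq> V"
    "edge_perm s (V - set xs)" "card (V - set xs) = card V - length xs"
    using edge_perm_split[OF assms(1)] assms(2) by (metis card.empty zero_neq_numeral)
  have "length xs \<noteq> 4" using edge_perm_card_neq_1[OF xs(5)] xs(6) assms(2) by auto
  then consider "length xs = 2" | "length xs = 3" | "length xs = 5" using xs assms(2) by linarith
  then show ?thesis
  proof cases
    case 1
    then obtain d e where de: "xs = [d,e]" "E d e" using cycle2 xs(1) by blast
    obtain a b c where abc: "V - set xs = {a,b,c}" "distinct [a,b,c]" "E a b" "E b c" "E c a"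
      by (rule edge_perm_card3[OF xs(5)]) (use xs(6) assms(2) 1 in simp_all)
    have V: "V = {a,b,c,d,e}" using abc(1) de(1) xs(4) by auto
    have D: "distinct [a,b,c,d,e]" using abc cycle_distinct[OF xs(1)] de by auto
    show ?thesis by (rule triangle[OF V D abc(3-5) de(2)])
  next
    case 2
    then obtain a b c where abc: "xs = [a,b,c]" "E a b" "E b c" "E c a" using cycle3 xs(1) by blast
    obtain d e where de: "V - set xs = {d,e}" "d \<noteq> e" "E d e"
      by (rule edge_perm_card2[OF xs(5)]) (use xs(6) assms(2) 2 in simp_all)
    have V: "V = {a,b,c,d,e}" using de(1) abc(1) xs(4) by auto
    have D: "distinct [a,b,c,d,e]" using de cycle_distinct[OF xs(1)] abc by auto
    show ?thesis by (rule triangle[OF V D abc(2-4) de(3)])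
  next
    case 3
    then obtain a b c d e where abc: "xs = [a,b,c,d,e]" "E a b" "E b c" "E c d" "E d e" "E e a"
      using cycle5 xs(1) by blast
    then have "{a,b,c,d,e} = V" using xs cycle_distinct[OF xs(1)] assms(2) fin
      by (intro card_subset_eq) auto
    then show ?thesis using cycle[of a b c d e] abc cycle_distinct[OF xs(1)] by auto
  qed
qed

text \<open>Without fixed points the cycle types are 7, 5+2, 4+3 and 3+2+2. The last two merge,
  since a 4-cycle contains two disjoint edges.\<close>

lemma edge_perm_card7:
  assumes "edge_perm s V" "card V = 7"
  obtains
    (cycle) a b c d e f g where "V = {a,b,c,d,e,f,g}" "distinct [a,b,c,d,e,f,g]"
      "E a b" "E b c" "E c d" "E d e" "E e f" "E f g" "E g a"
  | (pentagon) a b c d e f g where "V = {a,b,c,d,e,f,g}" "distinct [a,b,c,d,e,f,g]"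
      "E a b" "E b c" "E c d" "E d e" "E e a" "E f g"
  | (triangle) a b c d e f g where "V = {a,b,c,d,e,f,g}" "distinct [a,b,c,d,e,f,g]"
      "E a b" "E b c" "E c a" "E d e" "E f g"
proof -
  have fin: "finite V" using assms by (simp add: edge_perm_def)
  obtain xs where xs: "cycle xs" "2 \<le> length xs" "length xs \<le> card V" "set xs \<subseteq> V"
    "edge_perm s (V - set xs)" "card (V - set xs) = card V - length xs"
    using edge_perm_split[OF assms(1)] assms(2) by (metis card.empty zero_neq_numeral)
  have "length xs \<noteq> 6" using edge_perm_card_neq_1[OF xs(5)] xs(6) assms(2) by auto
  then consider "length xs = 2" | "length xs = 3" | "length xs = 4" | "length xs = 5" | "length xs = 7"
    using xs assms(2) by linarith
  then show ?thesis
  proof cases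
    case 1
    then obtain f g where fg: "xs = [f,g]" "E f g" using cycle2 xs(1) by blast
    note dist = cycle_distinct[OF xs(1)]
    have c5: "card (V - set xs) = 5" using xs(6) assms(2) 1 by auto
    show ?thesis
    proof (rule edge_perm_card5[OF xs(5) c5])
      fix a b c d e assume *: "V - set xs = {a,b,c,d,e}" "distinct [a,b,c,d,e]" "E a b" "E b c" "E c d" "E d e" "E e a"
      have V: "V = {a,b,c,d,e,f,g}" using *(1) fg(1) xs(4) by auto
      have D: "distinct [a,b,c,d,e,f,g]" using * dist fg by auto
      show ?thesis by (rule pentagon[OF V D *(3-7) fg(2)])
    next
      fix a b c d e assume *: "V - set xs = {a,b,c,d,e}" "distinct [a,b,c,d,e]" "E a b" "E b c" "E c a" "E d e"
      have V: "V = {a,b,c,d,e,f,g}" using *(1) fg(1) xs(4) by auto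
      have D: "distinct [a,b,c,d,e,f,g]" using * dist fg by auto
      show ?thesis by (rule triangle[OF V D *(3-6) fg(2)])
    qed
  next
    case 2
    then obtain a b c where abc: "xs = [a,b,c]" "E a b" "E b c" "E c a" using cycle3 xs(1) by blast
    obtain d e f g where de: "V - set xs = {d,e,f,g}" "distinct [d,e,f,g]" "E d e" "E f g"
      by (rule edge_perm_card4[OF xs(5)]) (use xs(6) assms(2) 2 in simp_all)
    have V: "V = {a,b,c,d,e,f,g}" using de(1) abc(1) xs(4) by auto
    have D: "distinct [a,b,c,d,e,f,g]" using de cycle_distinct[OF xs(1)] abc by auto
    show ?thesis by (rule triangle[OF V D abc(2-4) de(3,4)])
  next
    case 3
    then obtain d e f g where de: "xs = [d,e,f,g]" "E d e" "E f g" using cycle4 xs(1) by blast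
    obtain a b c where abc: "V - set xs = {a,b,c}" "distinct [a,b,c]" "E a b" "E b c" "E c a"
      by (rule edge_perm_card3[OF xs(5)]) (use xs(6) assms(2) 3 in simp_all)
    have V: "V = {a,b,c,d,e,f,g}" using abc(1) de(1) xs(4) by auto
    have D: "distinct [a,b,c,d,e,f,g]" using abc cycle_distinct[OF xs(1)] de by auto
    show ?thesis by (rule triangle[OF V D abc(3-5) de(2,3)])
  next
    case 4
    then obtain a b c d e where abc: "xs = [a,b,c,d,e]" "E a b" "E b c" "E c d" "E d e" "E e a"
      using cycle5 xs(1) by blast
    obtain f g where fg: "V - set xs = {f,g}" "f \<noteq> g" "E f g"
      by (rule edge_perm_card2[OF xs(5)]) (use xs(6) assms(2) 4 in simp_all)
    have "V = set xs \<union> {f,g}" "f \<notin> set xs" "g \<notin> set xs" using fg(1) xs(4) by blast+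
    then have V: "V = {a,b,c,d,e,f,g}" and D: "distinct [a,b,c,d,e,f,g]"
      using cycle_distinct[OF xs(1)] fg(2) unfolding abc(1) by auto
    show ?thesis by (rule pentagon[OF V D abc(2-6) fg(3)])
  next
    case 5
    then obtain a b c d e f g where abc: "xs = [a,b,c,d,e,f,g]"
      "E a b" "E b c" "E c d" "E d e" "E e f" "E f g" "E g a"
      using cycle7 xs(1) by blast
    have D: "distinct [a,b,c,d,e,f,g]" using cycle_distinct[OF xs(1)] abc(1) by simp
    have "set xs = V" using 5 assms(2) fin xs(4) distinct_card[OF cycle_distinct[OF xs(1)]]
      by (intro card_subset_eq) simp_all
    then have V: "V = {a,b,c,d,e,f,g}" using abc(1) by simp
    show ?thesis by (rule cycle[OF V D abc(2-8)])
  qed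
qed

end

subsection \<open>Classification of the small kernels\<close>

definition small_values :: "real set" where
  "small_values = {0, 1, 2, 5/2, 3, 7/2, 11/3}"

context ugraph
begin

text \<open>The classification in terms of certificates: a clique cover gives the lower bound
  \<open>h\<close>, which either reaches 4, so that no more needs to be known, or is matched by an
  upper bound and is then the exact entropy.\<close>

definition good :: "'a set \<Rightarrow> bool" where
  "good V \<longleftrightarrow> (\<exists>m h. cover E V m \<and> real (card V) - real m / 6 = h \<and>
     (4 \<le> h \<or> h \<in> small_values \<and> UB E V h))"

lemma good_large: "cover E V m \<Longrightarrow> 24 + m \<le> 6 * card V \<Longrightarrow> good V"
  unfolding good_def by (intro exI[of _ m] exI[of _ "real (card V) - real m / 6"]) auto

lemma good_exact:
  "cover E V m \<Longrightarrow> real (card V) - real m / 6 = h \<Longrightarrow> h \<in> small_values \<Longrightarrow> UB E V h \<Longrightarrow> good V"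
  unfolding good_def by blast

lemma cover_edge_perm: "edge_perm s V \<Longrightarrow> cover E V (3 * card V)"
  unfolding edge_perm_def by (rule cover_of_permutation[of V s]) (use sym irr in metis)+

lemma UB_nonadjacent:
  assumes "finite V" "a \<in> V" "b \<in> V" "a \<noteq> b" "\<not> E a b"
  shows "UB E V (real (card V) - 2)"
proof -
  have "\<not> E u v" if "u \<in> {a,b}" "v \<in> {a,b}" for u v using that assms(5) sym irr by blast
  then show ?thesis using UB_independent[of V "{a,b}" E] assms by simp
qed

section \<open>Complete graphs and kernels with five vertices\<close>

lemma good_clique:
  assumes fin: "finite V" and "\<And>u v. u \<in> V \<Longrightarrow> v \<in> V \<Longrightarrow> u \<noteq> v \<Longrightarrow> E u v"
    and n: "card V \<in> {1,2,3,4} \<or> 5 \<le> card V"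
  shows "good V"
proof (cases "5 \<le> card V")
  case True
  have "cover E V 6" using assms(2) by (rule cover_clique)
  then show ?thesis by (rule good_large) (use True in simp)
next
  case False
  then obtain v where v: "v \<in> V" using n by (cases "V = {}") auto
  have c: "cover E V 6" using assms(2) by (rule cover_clique)
  have u: "UB E V (real (card V) - 1)"
    using UB_independent[of V "{v}" E] fin v irr by simp
  show ?thesis by (rule good_exact[OF c _ _ u]) (use False n in \<open>auto simp: small_values_def\<close>)
qed

text \<open>Triangle and edge give the lower bound 5 - 2 = 3, which a nonadjacent pair matches.
  Without such a pair the graph is complete and reaches 4.\<close>

lemma good_card5_triangle:
  assumes V: "V = {a,b,c,d,e}" and dist: "distinct [a,b,c,d,e]" and "E a b" "E b c" "E c a" "E d e"
  shows "good V"
proof (cases "\<forall>u\<in>V. \<forall>v\<in>V. u \<noteq> v \<longrightarrow> E u v")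
  case True
  have "card V = 5" using dist V by simp
  then show ?thesis using True V by (intro good_clique) auto
next
  case False
  have card: "card V = 5" using dist V by simp
  obtain u v where "u \<in> V" "v \<in> V" "u \<noteq> v" "\<not> E u v" using False by blast
  then have ub: "UB E V (real (card V) - 2)" by (intro UB_nonadjacent) (auto simp: V)
  have "cover E {a,b,c} 6" by (rule cover_clique) (use assms sym in blast)
  moreover have "cover E {d,e} 6" by (rule cover_clique) (use assms sym in blast)
  ultimately have c: "cover E ({a,b,c} \<union> {d,e}) (6 + 6)" by (rule cover_Un)
  have "{a,b,c} \<union> {d,e} = V" using V by auto
  with c have c: "cover E V 12" by simp
  show ?thesis by (rule good_exact[OF c _ _ ub]) (auto simp: card small_values_def)
qed

text \<open>A chord of the 5-cycle cuts off a triangle that is disjoint from an edge; without chords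
  the graph is the 5-cycle itself.\<close>

lemma good_card5:
  assumes s: "edge_perm s V" and card: "card V = 5"
  shows "good V"
  using s card
proof (cases rule: edge_perm_card5)
  case (triangle a b c d e)
  then show ?thesis by (rule good_card5_triangle)
next
  case (cycle a b c d e)
  note V = cycle(1) and dist = cycle(2) and cyc = cycle(3-7)
  show ?thesis
  proof (cases "E a c \<or> E b d \<or> E c e \<or> E d a \<or> E e b")
    case True
    then show ?thesis
    proof (elim disjE)
      assume "E a c"
      then show ?thesis using V dist cyc sym by (intro good_card5_triangle[of V a b c d e]) auto
    next
      assume "E b d"
      then show ?thesis using V dist cyc sym by (intro good_card5_triangle[of V b c d e a]) auto
    next
      assume "E c e"
      then show ?thesis using V dist cyc sym by (intro good_card5_triangle[of V c d e a b]) auto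
    next
      assume "E d a"
      then show ?thesis using V dist cyc sym by (intro good_card5_triangle[of V d e a b c]) auto
    next
      assume "E e b"
      then show ?thesis using V dist cyc sym by (intro good_card5_triangle[of V e a b c d]) auto
    qed
  next
    case False
    have "UB E V (5/2)" by (rule UB_C5[OF V dist sym irr]) (use False in auto)
    moreover have "cover E V 15" using cover_edge_perm[OF s] card by simp
    ultimately show ?thesis using card by (intro good_exact) (auto simp: small_values_def)
  qed
qed

section \<open>Kernels with seven vertices\<close>

lemma good_card7_triangle:
  assumes V: "V = {a,b,c,d,e,f,g}" and dist: "distinct [a,b,c,d,e,f,g]"
    and "E a b" "E b c" "E c a" "E d e" "E f g"
  shows "good V"
proof -
  have "cover E {a,b,c} 6" by (rule cover_clique) (use assms sym in blast)
  moreover have "cover E {d,e} 6" by (rule cover_clique) (use assms sym in blast)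
  moreover have "cover E {f,g} 6" by (rule cover_clique) (use assms sym in blast)
  ultimately have c: "cover E ({a,b,c} \<union> ({d,e} \<union> {f,g})) (6 + (6 + 6))" by (intro cover_Un)
  have "{a,b,c} \<union> ({d,e} \<union> {f,g}) = V" using V by auto
  with c have c: "cover E V 18" by simp
  \<comment> \<open>Three cliques on seven vertices give 7 - 3 = 4.\<close>
  show ?thesis by (rule good_large[OF c]) (use dist V in simp)
qed

text \<open>The lower bound 7/2 comes from \<open>cover\<close> instead of from the edges of the
  7-cycle. The lemma thus also serves spanning subgraphs of this pattern that miss some of these
  edges.\<close>

lemma good_C7_wlog:
  assumes V: "V = {a0,a1,a2,a3,a4,a5,a6}" and dist: "distinct [a0,a1,a2,a3,a4,a5,a6]"
    and cover: "cover E V 21"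
    and "\<not> E a0 a2" "\<not> E a1 a3" "\<not> E a2 a4" "\<not> E a3 a5" "\<not> E a4 a6" "\<not> E a5 a0" "\<not> E a6 a1"
      "\<not> E a1 a4" "\<not> E a2 a5" "\<not> E a3 a6" "\<not> E a4 a0"
  shows "good V"
proof -
  have "UB E V (7/2)" by (rule UB_C7_chords[OF V dist sym irr]) (use assms in auto)
  moreover have "card V = 7" using V dist by simp
  ultimately show ?thesis using cover by (intro good_exact) (auto simp: small_values_def)
qed

text \<open>A chord skipping one vertex closes a triangle and leaves two disjoint edges. So do two
  longer chords with a common endpoint, together with the cycle edge between their other ends. Only
  pairwise disjoint long chords survive.\<close>

lemma good_C7:
  assumes V: "V = {a0,a1,a2,a3,a4,a5,a6}" and dist: "distinct [a0,a1,a2,a3,a4,a5,a6]"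
    and cover: "cover E V 21"
    and cyc: "E a0 a1" "E a1 a2" "E a2 a3" "E a3 a4" "E a4 a5" "E a5 a6" "E a6 a0"
  shows "good V"
proof (rule ccontr)
  assume bad: "\<not> good V"
  have rot: "V = {a1,a2,a3,a4,a5,a6,a0}" "V = {a2,a3,a4,a5,a6,a0,a1}" "V = {a3,a4,a5,a6,a0,a1,a2}"
    "V = {a4,a5,a6,a0,a1,a2,a3}" "V = {a5,a6,a0,a1,a2,a3,a4}" "V = {a6,a0,a1,a2,a3,a4,a5}"
    using V by auto
  have short: "\<not> E x0 x2"
    if "V = {x0,x1,x2,x3,x4,x5,x6}" "distinct [x0,x1,x2,x3,x4,x5,x6]" "E x0 x1" "E x1 x2" "E x3 x4" "E x5 x6"
    for x0 x1 x2 x3 x4 x5 x6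
    using good_card7_triangle[of V x0 x1 x2 x3 x4 x5 x6] bad that sym by blast
  have long: "\<not> E x0 x3 \<or> \<not> E x3 x6"
    if "V = {x0,x1,x2,x3,x4,x5,x6}" "distinct [x0,x1,x2,x3,x4,x5,x6]" "E x1 x2" "E x4 x5" "E x6 x0"
    for x0 x1 x2 x3 x4 x5 x6
  proof -
    have "V = {x0,x3,x6,x1,x2,x4,x5}" using that(1) by auto
    moreover have "distinct [x0,x3,x6,x1,x2,x4,x5]" using that(2) by auto
    ultimately show ?thesis using good_card7_triangle[of V x0 x3 x6 x1 x2 x4 x5] bad that by blast
  qed
  have D: "distinct [a1,a2,a3,a4,a5,a6,a0]" "distinct [a2,a3,a4,a5,a6,a0,a1]" "distinct [a3,a4,a5,a6,a0,a1,a2]"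
    "distinct [a4,a5,a6,a0,a1,a2,a3]" "distinct [a5,a6,a0,a1,a2,a3,a4]" "distinct [a6,a0,a1,a2,a3,a4,a5]"
    using dist by auto
  note s = short[OF V dist cyc(1,2,4,6)] short[OF rot(1) D(1) cyc(2,3,5,7)] short[OF rot(2) D(2) cyc(3,4,6,1)]
    short[OF rot(3) D(3) cyc(4,5,7,2)] short[OF rot(4) D(4) cyc(5,6,1,3)] short[OF rot(5) D(5) cyc(6,7,2,4)]
    short[OF rot(6) D(6) cyc(7,1,3,5)]
  note l = long[OF V dist cyc(2,5,7)] long[OF rot(1) D(1) cyc(3,6,1)] long[OF rot(2) D(2) cyc(4,7,2)]
    long[OF rot(3) D(3) cyc(5,1,3)] long[OF rot(4) D(4) cyc(6,2,4)] long[OF rot(5) D(5) cyc(7,3,5)]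
    long[OF rot(6) D(6) cyc(1,4,6)]
  note w = good_C7_wlog[OF V dist cover] good_C7_wlog[OF rot(1) D(1) cover] good_C7_wlog[OF rot(2) D(2) cover]
    good_C7_wlog[OF rot(3) D(3) cover] good_C7_wlog[OF rot(4) D(4) cover] good_C7_wlog[OF rot(5) D(5) cover]
    good_C7_wlog[OF rot(6) D(6) cover]
  note p = bad s
  \<comment> \<open>Each rotation of the admissible pattern fails, so among any four cyclically
    consecutive chords \<open>ai a(i+3)\<close> one is present. Disjointness excludes this: pairwise
    disjoint long chords always fit into three consecutive positions.\<close>
  have "E a1 a4 \<or> E a2 a5 \<or> E a3 a6 \<or> E a4 a0" using w(1) p by blast
  moreover have "E a2 a5 \<or> E a3 a6 \<or> E a4 a0 \<or> E a5 a1" using w(2) p by blast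
  moreover have "E a3 a6 \<or> E a4 a0 \<or> E a5 a1 \<or> E a6 a2" using w(3) p by blast
  moreover have "E a4 a0 \<or> E a5 a1 \<or> E a6 a2 \<or> E a0 a3" using w(4) p by blast
  moreover have "E a5 a1 \<or> E a6 a2 \<or> E a0 a3 \<or> E a1 a4" using w(5) p by blast
  moreover have "E a6 a2 \<or> E a0 a3 \<or> E a1 a4 \<or> E a2 a5" using w(6) p by blast
  moreover have "E a0 a3 \<or> E a1 a4 \<or> E a2 a5 \<or> E a3 a6" using w(7) p by blast
  ultimately show False using l by argo
qed

text \<open>With weight 1/3 on the triangle \<open>z a2 a3\<close>, the remaining 6 units of vertex weight can be
  covered exactly by edges, for a total of 10/3.\<close>

lemma cover_C5_path_triangle:
  assumes V: "V = {a0,a1,a2,a3,a4,w,z}" and dist: "distinct [a0,a1,a2,a3,a4,w,z]"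
    and edges: "E a0 a1" "E a1 a2" "E a2 a3" "E a3 a4" "E a4 a0" "E w z" "E w a0" "E z a2" "E z a3"
  shows "cover E V 20"
proof (rule coverI)
  let ?Cs = "replicate 2 {z,a2,a3} @ replicate 4 {w,z} @ replicate 2 {w,a0} @ replicate 2 {a0,a1} @
    replicate 2 {a0,a4} @ replicate 4 {a1,a2} @ replicate 4 {a3,a4}"
  show "length ?Cs = 20" by simp
  show "E u v" if "C \<in> set ?Cs" "u \<in> C" "v \<in> C" "u \<noteq> v" for C u v
    using that edges edges[THEN sym] by (auto split: if_splits)
  show "6 \<le> length (filter (\<lambda>C. v \<in> C) ?Cs)" if "v \<in> V" for v
    using that dist V by (auto simp: filter_replicate)
qed

lemma good_C5_path_triangle:
  assumes V: "V = {a0,a1,a2,a3,a4,w,z}" and dist: "distinct [a0,a1,a2,a3,a4,w,z]"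
    and edges: "E a0 a1" "E a1 a2" "E a2 a3" "E a3 a4" "E a4 a0" "E w z" "E w a0" "E z a2" "E z a3"
    and non: "\<not> E a0 a2" "\<not> E a1 a3" "\<not> E a2 a4" "\<not> E a3 a0" "\<not> E a4 a1"
      "\<not> E w a1" "\<not> E w a2" "\<not> E w a3" "\<not> E w a4" "\<not> E z a0" "\<not> E z a1" "\<not> E z a4"
  shows "good V"
proof -
  have ub: "UB E V (11/3)" by (rule UB_C5_path_triangle[OF V dist sym irr]) (use non in auto)
  have card: "card V = 7" using V dist by simp
  show ?thesis
    by (rule good_exact[OF cover_C5_path_triangle[OF V dist edges] _ _ ub])
      (simp_all add: card small_values_def)
qed

text \<open>Almost every further edge creates a triangle with two disjoint edges or a spanning
  7-cycle. Only \<open>z a3\<close> or \<open>w a4\<close> may be added, and not both.\<close>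

lemma good_pentagon_attached:
  assumes V: "V = {a0,a1,a2,a3,a4,w,z}" and dist: "distinct [a0,a1,a2,a3,a4,w,z]"
    and cover: "cover E V 21"
    and edges: "E a0 a1" "E a1 a2" "E a2 a3" "E a3 a4" "E a4 a0" "E w z" "E w a0" "E z a2"
  shows "good V"
proof (rule ccontr)
  assume bad: "\<not> good V"
  note e = edges edges[THEN sym]
  have tri: "\<not> (E b0 b1 \<and> E b1 b2 \<and> E b2 b0 \<and> E b3 b4 \<and> E b5 b6)"
    if "V = {b0,b1,b2,b3,b4,b5,b6}" "distinct [b0,b1,b2,b3,b4,b5,b6]" for b0 b1 b2 b3 b4 b5 b6
    using good_card7_triangle[OF that] bad by blast
  have sev: "\<not> (E b0 b1 \<and> E b1 b2 \<and> E b2 b3 \<and> E b3 b4 \<and> E b4 b5 \<and> E b5 b6 \<and> E b6 b0)"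
    if "V = {b0,b1,b2,b3,b4,b5,b6}" "distinct [b0,b1,b2,b3,b4,b5,b6]" for b0 b1 b2 b3 b4 b5 b6
    using good_C7[OF that cover] bad by blast
  have c1: "\<not> E a0 a2" using tri[of a0 a1 a2 a3 a4 w z] V dist e sym by auto
  have c2: "\<not> E a1 a3" using tri[of a1 a2 a3 a4 a0 w z] V dist e sym by auto
  have c3: "\<not> E a2 a4" using tri[of a2 a3 a4 a0 a1 w z] V dist e sym by auto
  have c4: "\<not> E a3 a0" using tri[of a3 a4 a0 a1 a2 w z] V dist e sym by auto
  have c5: "\<not> E a4 a1" using tri[of a4 a0 a1 a2 a3 w z] V dist e sym by auto
  have z0: "\<not> E z a0" using tri[of z a0 w a1 a2 a3 a4] V dist e sym by auto
  have w2: "\<not> E w a2" using tri[of w a2 z a0 a1 a3 a4] V dist e sym by auto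
  have z1: "\<not> E z a1" using sev[of a1 a2 a3 a4 a0 w z] V dist e sym by auto
  have w1: "\<not> E w a1" using sev[of a2 a3 a4 a0 a1 w z] V dist e sym by auto
  have z4: "\<not> E z a4" using sev[of a4 a3 a2 a1 a0 w z] V dist e sym by auto
  have w3: "\<not> E w a3" using sev[of a2 a1 a0 a4 a3 w z] V dist e sym by auto
  have w4: "\<not> (E w a4 \<and> E z a3)" using sev[of a3 a2 a1 a0 a4 w z] V dist e sym by auto
  note non = c1 c2 c3 c4 c5 z0 z1 z4 w1 w2 w3
  note non' = non non[THEN contrapos_nn, OF sym]
  show False
  proof (cases "E z a3 \<or> E w a4")
    case True
    then show False
    proof
      assume "E z a3"
      then have "good V"
        by (intro good_C5_path_triangle[OF V dist]) (use w4 e non in auto)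
      then show False using bad by simp
    next
      \<comment> \<open>The reflection exchanging \<open>w\<close> with \<open>z\<close>,
        \<open>a0\<close> with \<open>a2\<close> and \<open>a3\<close> with \<open>a4\<close> turns
        this into the previous case.\<close>
      assume *: "E w a4"
      have "good V"
      proof (rule good_C5_path_triangle)
        show "V = {a2,a1,a0,a4,a3,z,w}" using V by auto
        show "distinct [a2,a1,a0,a4,a3,z,w]" using dist by auto
      qed (use * w4 e non' in auto)
      then show False using bad by simp
    qed
  next
    case False
    \<comment> \<open>Only the eight edges of \<open>edges\<close> remain. In the order used here
      five of them lie on a 7-cycle, and \<open>a4 a0\<close>, \<open>a3 a2\<close>,
      \<open>w z\<close> are the three disjoint chords.\<close>
    have "good V"
    proof (rule good_C7_wlog)
      show "V = {a4,a3,w,a0,a1,a2,z}" using V by auto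
      show "distinct [a4,a3,w,a0,a1,a2,z]" using dist by auto
    qed (use cover False non' sym in auto)
    then show False using bad by simp
  qed
qed

text \<open>If \<open>z\<close> shares the neighbour \<open>a0\<close> with \<open>w\<close>, a
  triangle arises; if it attaches next to \<open>a0\<close>, the path through \<open>w z\<close>
  extends the pentagon to a 7-cycle. The two positions at distance two are mirror images.\<close>

lemma good_pentagon_wlog:
  assumes V: "V = {a0,a1,a2,a3,a4,w,z}" and dist: "distinct [a0,a1,a2,a3,a4,w,z]"
    and cover: "cover E V 21"
    and edges: "E a0 a1" "E a1 a2" "E a2 a3" "E a3 a4" "E a4 a0" "E w z" "E w a0"
    and z: "E z a0 \<or> E z a1 \<or> E z a2 \<or> E z a3 \<or> E z a4"
  shows "good V"
  using z
proof (elim disjE)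
  assume *: "E z a0"
  have V': "V = {w,z,a0,a1,a2,a3,a4}" using V by auto
  have D': "distinct [w,z,a0,a1,a2,a3,a4]" using dist by auto
  show ?thesis by (rule good_card7_triangle[OF V' D']) (simp_all add: edges edges[THEN sym] * *[THEN sym])
next
  assume *: "E z a1"
  have V': "V = {a1,a2,a3,a4,a0,w,z}" using V by auto
  have D': "distinct [a1,a2,a3,a4,a0,w,z]" using dist by auto
  show ?thesis by (rule good_C7[OF V' D' cover]) (simp_all add: edges edges[THEN sym] * *[THEN sym])
next
  assume *: "E z a2"
  show ?thesis by (rule good_pentagon_attached[OF V dist cover edges *])
next
  assume *: "E z a3"
  have V': "V = {a0,a4,a3,a2,a1,w,z}" using V by auto
  have D': "distinct [a0,a4,a3,a2,a1,w,z]" using dist by auto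
  show ?thesis by (rule good_pentagon_attached[OF V' D' cover]) (simp_all add: edges edges[THEN sym] * *[THEN sym])
next
  assume *: "E z a4"
  have V': "V = {a4,a3,a2,a1,a0,w,z}" using V by auto
  have D': "distinct [a4,a3,a2,a1,a0,w,z]" using dist by auto
  show ?thesis by (rule good_C7[OF V' D' cover]) (simp_all add: edges edges[THEN sym] * *[THEN sym])
qed

lemma good_pentagon:
  assumes V: "V = {a0,a1,a2,a3,a4,w,z}" and dist: "distinct [a0,a1,a2,a3,a4,w,z]"
    and cover: "cover E V 21"
    and edges: "E a0 a1" "E a1 a2" "E a2 a3" "E a3 a4" "E a4 a0" "E w z"
    and w: "E w a0 \<or> E w a1 \<or> E w a2 \<or> E w a3 \<or> E w a4"
    and z: "E z a0 \<or> E z a1 \<or> E z a2 \<or> E z a3 \<or> E z a4"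
  shows "good V"
  using w
proof (elim disjE)
  assume *: "E w a0"
  show ?thesis by (rule good_pentagon_wlog[OF V dist cover edges * z])
next
  assume *: "E w a1"
  have V': "V = {a1,a2,a3,a4,a0,w,z}" using V by auto
  have D': "distinct [a1,a2,a3,a4,a0,w,z]" using dist by auto
  have z': "E z a1 \<or> E z a2 \<or> E z a3 \<or> E z a4 \<or> E z a0" using z by blast
  show ?thesis by (rule good_pentagon_wlog[OF V' D' cover _ _ _ _ _ _ _ z']) (simp_all add: edges *)
next
  assume *: "E w a2"
  have V': "V = {a2,a3,a4,a0,a1,w,z}" using V by auto
  have D': "distinct [a2,a3,a4,a0,a1,w,z]" using dist by auto
  have z': "E z a2 \<or> E z a3 \<or> E z a4 \<or> E z a0 \<or> E z a1" using z by blast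
  show ?thesis by (rule good_pentagon_wlog[OF V' D' cover _ _ _ _ _ _ _ z']) (simp_all add: edges *)
next
  assume *: "E w a3"
  have V': "V = {a3,a4,a0,a1,a2,w,z}" using V by auto
  have D': "distinct [a3,a4,a0,a1,a2,w,z]" using dist by auto
  have z': "E z a3 \<or> E z a4 \<or> E z a0 \<or> E z a1 \<or> E z a2" using z by blast
  show ?thesis by (rule good_pentagon_wlog[OF V' D' cover _ _ _ _ _ _ _ z']) (simp_all add: edges *)
next
  assume *: "E w a4"
  have V': "V = {a4,a0,a1,a2,a3,w,z}" using V by auto
  have D': "distinct [a4,a0,a1,a2,a3,w,z]" using dist by auto
  have z': "E z a4 \<or> E z a0 \<or> E z a1 \<or> E z a2 \<or> E z a3" using z by blast
  show ?thesis by (rule good_pentagon_wlog[OF V' D' cover _ _ _ _ _ _ _ z']) (simp_all add: edges *)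
qed

lemma good_card7:
  assumes s: "edge_perm s V" and card: "card V = 7"
    and deg: "\<And>v. v \<in> V \<Longrightarrow> 2 \<le> card {u\<in>V. E v u}"
  shows "good V"
  using s card
proof (cases rule: edge_perm_card7)
  case (cycle a b c d e f g)
  have "cover E V 21" using cover_edge_perm[OF s] card by simp
  then show ?thesis using good_C7[OF cycle(1,2)] cycle by blast
next
  case (pentagon a b c d e w z)
  \<comment> \<open>By the degree condition \<open>w\<close> and \<open>z\<close> each have a
    neighbour besides one another, which must lie on the pentagon.\<close>
  have other: "\<exists>u\<in>V. E v u \<and> u \<noteq> x" if "v \<in> V" for v x
  proof (rule ccontr)
    assume "\<not> ?thesis"
    then have "{u\<in>V. E v u} \<subseteq> {x}" by blast
    then have "card {u\<in>V. E v u} \<le> card {x}" by (intro card_mono) auto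
    then show False using deg[OF that] by simp
  qed
  have w: "E w a \<or> E w b \<or> E w c \<or> E w d \<or> E w e"
    using other[of w z] pentagon(1) irr by auto
  have z: "E z a \<or> E z b \<or> E z c \<or> E z d \<or> E z e"
    using other[of z w] pentagon(1) irr by auto
  have "cover E V 21" using cover_edge_perm[OF s] card by simp
  then show ?thesis using good_pentagon[OF pentagon(1,2) _ pentagon(3-8) w z] by blast
next
  case (triangle a b c d e f g)
  then show ?thesis by (rule good_card7_triangle)
qed

section \<open>Kernels with six vertices\<close>

lemma good_wheel:
  assumes V: "V = {a0,a1,a2,a3,a4,w}" and dist: "distinct [a0,a1,a2,a3,a4,w]"
    and edges: "E a0 a1" "E a1 a2" "E a2 a3" "E a3 a4" "E a4 a0" "E w a2" "E w a3" "E w a4"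
    and non: "\<not> E a0 a2" "\<not> E a1 a3" "\<not> E a2 a4" "\<not> E a3 a0" "\<not> E a4 a1"
  shows "good V"
proof -
  have "UB E {a0,a1,a2,a3,a4} (5/2)"
    by (rule UB_C5[OF refl _ sym irr]) (use dist non in auto)
  then have "UB E (insert w {a0,a1,a2,a3,a4}) (5/2 + 1)" by (intro UB_insert) auto
  moreover have "insert w {a0,a1,a2,a3,a4} = V" using V by auto
  ultimately have ub: "UB E V (7/2)" by simp
  \<comment> \<open>The five pentagon edges with weight 1/2 each, where two consecutive ones are
    enlarged by \<open>w\<close> to triangles. This covers \<open>w\<close> at no extra
    weight.\<close>
  have c: "cover E V 15"
  proof (rule coverI)
    let ?Cs = "replicate 3 {w,a2,a3} @ replicate 3 {w,a3,a4} @ replicate 3 {a1,a2} @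
      replicate 3 {a4,a0} @ replicate 3 {a0,a1}"
    show "length ?Cs = 15" by simp
    show "E u v" if "C \<in> set ?Cs" "u \<in> C" "v \<in> C" "u \<noteq> v" for C u v
      using that edges edges[THEN sym] by (auto split: if_splits)
    show "6 \<le> length (filter (\<lambda>C. v \<in> C) ?Cs)" if "v \<in> V" for v
      using that dist V by (auto simp: filter_replicate)
  qed
  have card: "card V = 6" using V dist by simp
  show ?thesis by (rule good_exact[OF c _ _ ub]) (simp_all add: card small_values_def)
qed

text \<open>Two cliques covering six vertices give 6 - 2 = 4. Starting from a triangle, which exists
  by Ramsey's R(3,3) = 6, such a pair is found unless an induced pentagon appears; the sixth vertex
  then leads to \<open>good_wheel\<close>.\<close>

lemma good_card6:
  assumes card: "card V = 6"
    and indep: "\<And>x y z. {x,y,z} \<subseteq> V \<Longrightarrow> distinct [x,y,z] \<Longrightarrow> E x y \<or> E y z \<or> E x z"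
  shows "good V"
proof -
  have fin: "finite V" using card by (intro card_ge_0_finite) simp
  have two: "good V"
    if "\<And>u v. u \<in> A \<Longrightarrow> v \<in> A \<Longrightarrow> u \<noteq> v \<Longrightarrow> E u v"
       "\<And>u v. u \<in> B \<Longrightarrow> v \<in> B \<Longrightarrow> u \<noteq> v \<Longrightarrow> E u v" "A \<union> B = V" for A B
    using good_large[OF cover_Un[OF cover_clique[of A E] cover_clique[of B E]]] that card by simp
  have pent: "good V"
    if a: "{a0,a1,a2,a3,a4} \<subseteq> V" and dist: "distinct [a0,a1,a2,a3,a4]"
      and cyc: "E a0 a1" "E a1 a2" "E a2 a3" "E a3 a4" "E a4 a0"
      and non: "\<not> E a0 a2" "\<not> E a1 a3" "\<not> E a2 a4" "\<not> E a3 a0" "\<not> E a4 a1" for a0 a1 a2 a3 a4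
  proof -
    have "card (V - {a0,a1,a2,a3,a4}) = 1"
      using a card dist by (subst card_Diff_subset) auto
    then obtain w where w: "V - {a0,a1,a2,a3,a4} = {w}" by (auto simp: card_1_singleton_iff)
    then have V: "V = {a0,a1,a2,a3,a4,w}" and dist': "distinct [a0,a1,a2,a3,a4,w]"
      using a dist by auto
    \<comment> \<open>Since independent triples are excluded, the non-neighbours of \<open>w\<close>
      on the pentagon form a clique. They are at most two consecutive vertices, so \<open>w\<close>
      sees three consecutive ones.\<close>
    have wn: "E w a0 \<or> E w a2" "E w a1 \<or> E w a3" "E w a2 \<or> E w a4" "E w a3 \<or> E w a0" "E w a4 \<or> E w a1"
      using indep[of a0 w a2] indep[of a1 w a3] indep[of a2 w a4] indep[of a3 w a0] indep[of a4 w a1]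
        V dist' non sym by auto
    then consider "E w a2" "E w a3" "E w a4" | "E w a3" "E w a4" "E w a0" | "E w a4" "E w a0" "E w a1"
      | "E w a0" "E w a1" "E w a2" | "E w a1" "E w a2" "E w a3" by blast
    then show ?thesis
    proof cases
      case 1
      show ?thesis by (rule good_wheel[OF V dist' cyc 1 non])
    next
      case 2
      have "V = {a1,a2,a3,a4,a0,w}" "distinct [a1,a2,a3,a4,a0,w]" using V dist' by auto
      then show ?thesis by (rule good_wheel) (use 2 cyc non in simp_all)
    next
      case 3
      have "V = {a2,a3,a4,a0,a1,w}" "distinct [a2,a3,a4,a0,a1,w]" using V dist' by auto
      then show ?thesis by (rule good_wheel) (use 3 cyc non in simp_all)
    next
      case 4
      have "V = {a3,a4,a0,a1,a2,w}" "distinct [a3,a4,a0,a1,a2,w]" using V dist' by auto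
      then show ?thesis by (rule good_wheel) (use 4 cyc non in simp_all)
    next
      case 5
      have "V = {a4,a0,a1,a2,a3,w}" "distinct [a4,a0,a1,a2,a3,w]" using V dist' by auto
      then show ?thesis by (rule good_wheel) (use 5 cyc non in simp_all)
    qed
  qed
  obtain T where T: "T \<subseteq> V" "card T = 3" "\<And>x y. x \<in> T \<Longrightarrow> y \<in> T \<Longrightarrow> x \<noteq> y \<Longrightarrow> E x y"
  proof -
    note found = that
    \<comment> \<open>Ramsey argument: \<open>v\<close> has three neighbours or three
      non-neighbours. Three non-neighbours are pairwise adjacent, and among three neighbours some
      two are adjacent and form a triangle with \<open>v\<close>.\<close>
    obtain v where v: "v \<in> V" using card by fastforce
    let ?B = "{u\<in>V. E v u}" and ?A = "{u\<in>V. u \<noteq> v \<and> \<not> E v u}"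
    have "V = insert v (?A \<union> ?B)" using v by auto
    then have "card V = card (insert v (?A \<union> ?B))" by (rule arg_cong)
    also have "\<dots> \<le> Suc (card (?A \<union> ?B))" using fin by (simp add: card_insert_if)
    also have "\<dots> \<le> Suc (card ?A + card ?B)" using card_Un_le[of ?A ?B] by simp
    finally have "card V \<le> Suc (card ?A + card ?B)" .
    then have "3 \<le> card ?A \<or> 3 \<le> card ?B" unfolding card by linarith
    then consider "3 \<le> card ?A" | "3 \<le> card ?B" by blast
    then show ?thesis
    proof cases
      case 1
      then obtain T where T: "T \<subseteq> ?A" "card T = 3" by (rule obtain_subset_with_card_n)
      have "E x y" if "x \<in> T" "y \<in> T" "x \<noteq> y" for x y
      proof -
        have "x \<in> ?A" "y \<in> ?A" using that T by blast+
        then show ?thesis using indep[of x v y] v that sym by auto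
      qed
      then show ?thesis using found T by blast
    next
      case 2
      then obtain S where S: "S \<subseteq> ?B" "card S = 3" by (rule obtain_subset_with_card_n)
      then obtain x y z where xyz: "S = {x,y,z}" "distinct [x,y,z]"
        by (auto simp: card_3_iff)
      have B: "x \<in> ?B" "y \<in> ?B" "z \<in> ?B" using S xyz by auto
      have clique: ?thesis if "p \<in> ?B" "q \<in> ?B" "E p q" for p q
      proof (rule found)
        have "p \<noteq> q" "p \<noteq> v" "q \<noteq> v" using that irr by auto
        then show "{v,p,q} \<subseteq> V" "card {v,p,q} = 3" using that v by auto
        show "E x y" if "x \<in> {v,p,q}" "y \<in> {v,p,q}" "x \<noteq> y" for x y
          using that \<open>p \<in> ?B\<close> \<open>q \<in> ?B\<close> \<open>E p q\<close> sym by auto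
      qed
      have "E x y \<or> E y z \<or> E x z" using indep[of x y z] xyz S by auto
      then show ?thesis using clique B by blast
    qed
  qed
  have finT: "finite T" using T fin finite_subset by blast
  have cU: "card (V - T) = 3" using T card by (simp add: card_Diff_subset finT)
  then obtain p0 q0 r0 where U0: "V - T = {p0,q0,r0}" "distinct [p0,q0,r0]"
    by (auto simp: card_3_iff)
  show ?thesis
  proof (cases "E p0 q0 \<and> E q0 r0 \<and> E p0 r0")
    case True
    show ?thesis
      by (rule two[of T "{p0,q0,r0}"]) (use T U0 True sym in auto)
  next
    case False
    then obtain p q r where U: "V - T = {p,q,r}" "distinct [p,q,r]" "\<not> E p q"
    proof -
      have "V - T = {q0,r0,p0}" "V - T = {p0,r0,q0}" using U0(1) by auto
      then show ?thesis using False U0 that[of p0 q0 r0] that[of q0 r0 p0] that[of p0 r0 q0] by auto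
    qed
    have pV: "p \<in> V" "q \<in> V" "r \<in> V" "p \<notin> T" "q \<notin> T" "r \<notin> T" using U(1) by blast+
    \<comment> \<open>As \<open>p\<close> and \<open>q\<close> are not adjacent, every other vertex
      sees one of them.\<close>
    have r: "E r p \<or> E r q" using indep[of p r q] U pV sym by auto
    have t: "E t p \<or> E t q" if "t \<in> T" for t
      using indep[of p t q] U pV that T(1) sym by auto
    text \<open>Give one of \<open>p\<close>, \<open>q\<close> all its neighbours in \<open>T\<close>, and the other one \<open>r\<close> and the rest of \<open>T\<close>. One
      of these choices yields two cliques, unless \<open>p r q\<close> closes up to an induced pentagon through \<open>T\<close>.\<close>
    have key: "good V" if pq: "{p',q'} = {p,q}" "E r q'" and R: "\<And>t. t \<in> T \<Longrightarrow> \<not> E t p' \<Longrightarrow> E t r" for p' q'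
    proof (rule two)
      let ?A = "insert p' {t\<in>T. E t p'}" and ?B = "insert r (insert q' {t\<in>T. \<not> E t p'})"
      have tq: "E t q'" if "t \<in> T" "\<not> E t p'" for t using t[OF that(1)] that(2) pq(1) by (auto simp: doubleton_eq_iff)
      show "E u v" if "u \<in> ?A" "v \<in> ?A" "u \<noteq> v" for u v using that T(3) sym by auto
      show "E u v" if "u \<in> ?B" "v \<in> ?B" "u \<noteq> v" for u v using that T(3) sym pq(2) R tq by auto
      show "?A \<union> ?B = V" using U(1) pq(1) T(1) by (auto simp: doubleton_eq_iff)
    qed
    show ?thesis
    proof (cases "E r p \<and> E r q")
      case False
      \<comment> \<open>If \<open>r\<close> misses one of \<open>p\<close>, \<open>q\<close>, every
        \<open>t\<close> missing the same vertex is adjacent to \<open>r\<close>, which is the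
        condition \<open>R\<close> of \<open>key\<close>.\<close>
      have far: "E t r" if "t \<in> T" "\<not> E t x" "\<not> E r x" "x \<in> {p,q}" for t x
        using indep[of t r x] that T(1) pV U(2) by auto
      show ?thesis using r False key[of p q] key[of q p] far by (auto simp: insert_commute)
    next
      case True
      show ?thesis
      proof (cases "(\<forall>t\<in>T. \<not> E t p \<longrightarrow> E t r) \<or> (\<forall>t\<in>T. \<not> E t q \<longrightarrow> E t r)")
        case True
        then show ?thesis using key[of p q] key[of q p] \<open>E r p \<and> E r q\<close> by (auto simp: insert_commute)
      next
        case False
        \<comment> \<open>The witnesses against the two choices: \<open>x\<close> misses
          \<open>p\<close> and \<open>r\<close>, \<open>y\<close> misses \<open>q\<close> and
          \<open>r\<close>. With \<open>p r q\<close> they form the induced pentagon.\<close>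
        then obtain x y where xy: "x \<in> T" "\<not> E x p" "\<not> E x r" "y \<in> T" "\<not> E y q" "\<not> E y r" by blast
        have "E x q" "E y p" using t xy by blast+
        then have "x \<noteq> y" using xy by blast
        then have "E x y" using T(3) xy by blast
        show ?thesis
          by (rule pent[of p r q x y])
            (use xy U pV T(1) True \<open>E x q\<close> \<open>E y p\<close> \<open>x \<noteq> y\<close> \<open>E x y\<close> sym in auto)
      qed
    qed
  qed
qed

end

subsection \<open>Crown reduction\<close>

context ugraph
begin

definition nbhd :: "'a set \<Rightarrow> 'a set \<Rightarrow> 'a set" where
  "nbhd V S = {v\<in>V. \<exists>u\<in>S. E u v}"

definition indep :: "'a set \<Rightarrow> bool" where
  "indep I \<longleftrightarrow> (\<forall>u\<in>I. \<forall>v\<in>I. \<not> E u v)"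

text \<open>Hall's condition for \<open>S\<close> reduces to independent sets:
  \<open>S - nbhd V S\<close> is independent with all its neighbours in \<open>nbhd V S - S\<close>,
  while \<open>S \<inter> nbhd V S\<close> counts equally on both sides.\<close>

lemma edge_perm_of_no_crown:
  assumes fin: "finite V"
    and no_crown: "\<And>I. I \<subseteq> V \<Longrightarrow> I \<noteq> {} \<Longrightarrow> indep I \<Longrightarrow> card I \<le> card (nbhd V I)"
  obtains s where "edge_perm s V"
proof -
  let ?N = "\<lambda>a. {v\<in>V. E a v}"
  have finN: "finite (nbhd V S)" for S using fin by (simp add: nbhd_def)
  have "\<exists>s. inj_on s V \<and> (\<forall>a\<in>V. s a \<in> ?N a)"
  proof (rule hall)
    fix S assume S: "S \<subseteq> V"
    have finS: "finite S" using S fin finite_subset by blast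
    let ?I = "S - nbhd V S"
    have "indep ?I" using S by (auto simp: indep_def nbhd_def)
    have "card ?I \<le> card (nbhd V ?I)"
    proof (cases "?I = {}")
      case True
      then show ?thesis by (metis card.empty le0)
    next
      case False
      then show ?thesis using no_crown[of ?I] S \<open>indep ?I\<close> by blast
    qed
    also have "\<dots> \<le> card (nbhd V S - S)"
    proof (rule card_mono)
      show "nbhd V ?I \<subseteq> nbhd V S - S" using S sym by (auto simp: nbhd_def)
    qed (use finN in simp)
    finally have "card ?I \<le> card (nbhd V S - S)" .
    moreover have "card S = card ?I + card (S \<inter> nbhd V S)"
      using card_Int_Diff[OF finS, of "nbhd V S"] by simp
    moreover have "card (nbhd V S) = card (nbhd V S - S) + card (S \<inter> nbhd V S)"
      using card_Int_Diff[OF finN, of S S] by (simp add: Int_commute)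
    moreover have "\<Union>(?N ` S) = nbhd V S" by (auto simp: nbhd_def)
    ultimately show "card S \<le> card (\<Union>(?N ` S))" by simp
  qed (use fin in auto)
  then obtain s where "inj_on s V" "\<forall>a\<in>V. s a \<in> ?N a" by blast
  then have "edge_perm s V" using fin by (auto simp: edge_perm_def)
  then show ?thesis using that by blast
qed

text \<open>\<open>I\<close> is chosen of minimal size. If Hall's condition failed for some
  \<open>T\<close>, removing the neighbours of \<open>T\<close> from \<open>I\<close> would remove
  from \<open>nbhd V I\<close> at least all of \<open>T\<close>, hence more vertices than from
  \<open>I\<close>, and leave a smaller candidate.\<close>

lemma crown_matching:
  assumes fin: "finite V" and "I0 \<subseteq> V" "I0 \<noteq> {}" "indep I0" "card (nbhd V I0) \<le> card I0"
  obtains I f where "I \<subseteq> V" "I \<noteq> {}" "indep I" "inj_on f (nbhd V I)"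
    "\<And>u. u \<in> nbhd V I \<Longrightarrow> f u \<in> I \<and> E u (f u)"
proof -
  let ?P = "\<lambda>I. I \<subseteq> V \<and> I \<noteq> {} \<and> indep I \<and> card (nbhd V I) \<le> card I"
  define I where "I = arg_min card ?P"
  have I: "?P I" unfolding I_def by (rule arg_min_natI[of ?P I0]) (use assms in blast)
  have min: "card I \<le> card J" if "?P J" for J
    unfolding I_def by (rule arg_min_nat_le) (use that in blast)
  have finI: "finite I" using I fin finite_subset by blast
  let ?N = "nbhd V I"
  let ?M = "\<lambda>u. {i\<in>I. E u i}"
  have finN: "finite (nbhd V S)" for S using fin by (simp add: nbhd_def)
  have "\<exists>f. inj_on f ?N \<and> (\<forall>u\<in>?N. f u \<in> ?M u)"
  proof (rule hall)
    fix T assume T: "T \<subseteq> ?N"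
    have finT: "finite T" using T finN finite_subset by blast
    show "card T \<le> card (\<Union>(?M ` T))"
    proof (rule ccontr)
      assume less: "\<not> ?thesis"
      let ?J = "I - \<Union>(?M ` T)"
      have MI: "\<Union>(?M ` T) \<subseteq> I" by blast
      have cJ: "card ?J = card I - card (\<Union>(?M ` T))"
        using MI finI by (intro card_Diff_subset) (auto intro: finite_subset)
      have TI: "card T \<le> card I" using card_mono[OF finN T] I by linarith
      have "nbhd V ?J \<subseteq> ?N - T" using sym by (auto simp: nbhd_def)
      then have "card (nbhd V ?J) \<le> card (?N - T)" using finN by (intro card_mono) auto
      also have "\<dots> = card ?N - card T" by (rule card_Diff_subset[OF finT T])
      finally have nJ: "card (nbhd V ?J) < card ?J" using less cJ TI I by linarith
      have "?J \<noteq> {}" using nJ by (metis card.empty not_less0)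
      moreover have "indep ?J" using I by (auto simp: indep_def)
      ultimately have "?P ?J" using I nJ less_imp_le by blast
      then have "card I \<le> card ?J" by (rule min)
      moreover have "T \<noteq> {}" using less by auto
      then obtain t where "t \<in> T" by blast
      then obtain i where "i \<in> I" "E i t" using T by (auto simp: nbhd_def)
      then have "i \<in> \<Union>(?M ` T)" using \<open>t \<in> T\<close> sym by blast
      then have "?J \<subset> I" using \<open>i \<in> I\<close> by blast
      then have "card ?J < card I" using finI by (rule psubset_card_mono[rotated])
      ultimately show False by simp
    qed
  qed (use finN finI in auto)
  then obtain f where "inj_on f ?N" "\<forall>u\<in>?N. f u \<in> ?M u" by blast
  then show ?thesis using that[of I f] I by blast
qed

text \<open>Below 4 the only non-integral sum with \<open>k > 0\<close> is 5/2 + 1 = 7/2; both 7/2 +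
  1 and 11/3 + 1 exceed 4.\<close>

lemma small_values_add:
  assumes "h \<in> small_values" "h + real k < 4"
  shows "h + real k \<in> small_values"
proof -
  have "h \<ge> 0" using assms(1) by (auto simp: small_values_def)
  then have "k \<in> {0,1,2,3}" using assms(2) by auto
  then show ?thesis using assms by (auto simp: small_values_def)
qed

text \<open>Lower bound: each \<open>i\<close> in \<open>I\<close> together with its partner, if
  any, is a clique, so \<open>card I\<close> cliques cover the crown. Upper bound: without
  \<open>nbhd V I\<close> the vertices of \<open>I\<close> are isolated, and putting
  \<open>nbhd V I\<close> back adds at most its cardinality. Both increase \<open>h\<close> by
  \<open>card (nbhd V I)\<close>.\<close>

lemma good_crown:
  assumes fin: "finite V" and I: "I \<subseteq> V" "indep I" and f: "inj_on f (nbhd V I)"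
    "\<And>u. u \<in> nbhd V I \<Longrightarrow> f u \<in> I \<and> E u (f u)"
    and good: "good (V - (I \<union> nbhd V I))"
  shows "good V"
proof -
  let ?N = "nbhd V I" and ?W = "V - (I \<union> nbhd V I)"
  have finI: "finite I" using I fin finite_subset by blast
  have finN: "finite ?N" using fin by (simp add: nbhd_def)
  have disj: "I \<inter> ?N = {}" using I(2) by (auto simp: nbhd_def indep_def)
  have V: "V = ?W \<union> I \<union> ?N" using I(1) by (auto simp: nbhd_def)
  have "card (?W \<union> I) = card ?W + card I"
    using fin finI by (intro card_Un_disjoint) auto
  moreover have "card (?W \<union> I \<union> ?N) = card (?W \<union> I) + card ?N"
    using fin finI finN disj by (intro card_Un_disjoint) auto
  ultimately have card: "card V = card ?W + card I + card ?N" using V by simp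
  obtain m h where m: "cover E ?W m" "real (card ?W) - real m / 6 = h"
    "4 \<le> h \<or> h \<in> small_values \<and> UB E ?W h"
    using good unfolding good_def by blast
  have "cover E (\<Union>i\<in>I. insert i {u\<in>?N. f u = i}) (6 * card I)"
  proof (rule cover_UN_cliques[OF finI])
    fix i u v assume *: "i \<in> I" "u \<in> insert i {u\<in>?N. f u = i}" "v \<in> insert i {u\<in>?N. f u = i}" "u \<noteq> v"
    have "u = i \<or> v = i"
    proof (rule ccontr)
      assume "\<not> ?thesis"
      then have "u \<in> ?N" "v \<in> ?N" "f u = f v" using * by auto
      then show False using f(1) *(4) by (auto dest: inj_onD)
    qed
    then show "E u v" using * f(2) sym by auto
  qed
  moreover have "(\<Union>i\<in>I. insert i {u\<in>?N. f u = i}) = I \<union> ?N" using f(2) by auto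
  ultimately have "cover E (I \<union> ?N) (6 * card I)" by simp
  then have "cover E (?W \<union> (I \<union> ?N)) (m + 6 * card I)" by (rule cover_Un[OF m(1)])
  then have c: "cover E V (m + 6 * card I)" using V unfolding Un_assoc by metis
  have eq: "real (card V) - real (m + 6 * card I) / 6 = h + card ?N"
    using m(2) card by (simp add: field_simps)
  show ?thesis
  proof (cases "4 \<le> h + card ?N")
    case True
    then show ?thesis using c eq unfolding good_def by blast
  next
    case False
    then have h: "h \<in> small_values" "UB E ?W h" using m(3) by auto
    have "UB E (?W \<union> I) h"
    proof (rule UB_Un_isolated[OF finI h(2)])
      show "\<not> E u v" if "v \<in> I" "u \<in> ?W \<union> I" for u v
        using that I(2) sym by (auto simp: nbhd_def indep_def)
    qed
    then have "UB E (?W \<union> I \<union> ?N) (h + card ?N)"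
      using fin finI finN by (intro UB_Un) auto
    then have "UB E V (h + card ?N)" using V by simp
    moreover have "h + card ?N \<in> small_values"
      by (rule small_values_add[OF h(1)]) (use False in simp)
    ultimately show ?thesis using good_exact[OF c eq] by blast
  qed
qed

text \<open>Strictness gives \<open>2 * card I < card V\<close> for independent \<open>I\<close>. So
  up to four vertices the graph is complete, on six there is no independent triple, and singletons
  yield minimum degree two. From eight vertices on, the permutation cover alone reaches 4.\<close>

lemma good_kernel:
  assumes fin: "finite V"
    and no_crown: "\<And>I. I \<subseteq> V \<Longrightarrow> I \<noteq> {} \<Longrightarrow> indep I \<Longrightarrow> card I < card (nbhd V I)"
  shows "good V"
proof -
  obtain s where s: "edge_perm s V"
    using edge_perm_of_no_crown[OF fin] no_crown less_imp_le by metis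
  have indep_bound: "2 * card I < card V" if I: "I \<subseteq> V" "I \<noteq> {}" "indep I" for I
  proof -
    have finI: "finite I" using I fin finite_subset by blast
    have "nbhd V I \<subseteq> V - I" using I(3) by (auto simp: nbhd_def indep_def)
    then have "card (nbhd V I) \<le> card (V - I)" using fin by (intro card_mono) auto
    then show ?thesis
      using no_crown[OF I] card_mono[OF fin I(1)] by (simp add: card_Diff_subset[OF finI I(1)])
  qed
  have clique: "good V" if "card V \<le> 4" "V \<noteq> {}"
  proof (rule good_clique[OF fin])
    show "card V \<in> {1,2,3,4} \<or> 5 \<le> card V"
    proof -
      have "card V \<noteq> 0" using that(2) fin by simp
      then have "card V = 1 \<or> card V = 2 \<or> card V = 3 \<or> card V = 4" using that(1) by linarith
      then show ?thesis by blast
    qed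
    show "E u v" if uv: "u \<in> V" "v \<in> V" "u \<noteq> v" for u v
    proof (rule ccontr)
      assume "\<not> E u v"
      then have "indep {u,v}" using irr sym by (auto simp: indep_def)
      then show False using indep_bound[of "{u,v}"] uv \<open>card V \<le> 4\<close> by simp
    qed
  qed
  consider "V = {}" | "V \<noteq> {}" "card V \<le> 4" | "card V = 5" | "card V = 6" | "card V = 7" | "8 \<le> card V"
    by linarith
  then show ?thesis
  proof cases
    case 1
    have "good {}" by (rule good_exact[OF cover_empty _ _ UB_empty]) (auto simp: small_values_def)
    then show ?thesis using 1 by simp
  next
    case 2
    then show ?thesis using clique by simp
  next
    case 3
    then show ?thesis using good_card5 s by blast
  next
    case 4
    show ?thesis
    proof (rule good_card6[OF 4])
      fix x y z assume *: "{x,y,z} \<subseteq> V" "distinct [x,y,z]"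
      show "E x y \<or> E y z \<or> E x z"
      proof (rule ccontr)
        assume "\<not> ?thesis"
        then have "indep {x,y,z}" using irr sym by (auto simp: indep_def)
        then show False using indep_bound[of "{x,y,z}"] * 4 by simp
      qed
    qed
  next
    case 5
    show ?thesis
    proof (rule good_card7[OF s 5])
      fix v assume "v \<in> V"
      moreover have "indep {v}" by (simp add: indep_def irr)
      moreover have "nbhd V {v} = {u\<in>V. E v u}" by (simp add: nbhd_def)
      ultimately show "2 \<le> card {u\<in>V. E v u}" using no_crown[of "{v}"] by simp
    qed
  next
    case 6
    show ?thesis by (rule good_large[OF cover_edge_perm[OF s]]) (use 6 in simp)
  qed
qed

lemma good_all: "finite V \<Longrightarrow> good V"
proof (induction "card V" arbitrary: V rule: less_induct)
  case less
  show ?case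
  proof (cases "\<forall>I. I \<subseteq> V \<longrightarrow> I \<noteq> {} \<longrightarrow> indep I \<longrightarrow> card I < card (nbhd V I)")
    case True
    then show ?thesis using good_kernel[OF less.prems] by blast
  next
    case False
    then obtain I0 where I0: "I0 \<subseteq> V" "I0 \<noteq> {}" "indep I0" "card (nbhd V I0) \<le> card I0"
      by (auto simp: not_less)
    obtain I f where I: "I \<subseteq> V" "I \<noteq> {}" "indep I" "inj_on f (nbhd V I)"
      "\<And>u. u \<in> nbhd V I \<Longrightarrow> f u \<in> I \<and> E u (f u)"
      using crown_matching[OF less.prems I0] by blast
    have "card (V - (I \<union> nbhd V I)) < card V"
      using I(1,2) less.prems by (intro psubset_card_mono) auto
    then have "good (V - (I \<union> nbhd V I))" using less by simp
    then show ?thesis using good_crown[OF less.prems I(1,3,4,5)] by blast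
  qed
qed


end

subsection \<open>The set of entropies\<close>

lemma entropy_small:
  assumes "simple_graph n E" "entropy n E \<le> 4"
  shows "entropy n E \<in> insert 4 small_values"
proof -
  \<comment> \<open>\<open>simple_graph\<close> constrains \<open>E\<close> only below
    \<open>n\<close>, whereas \<open>ugraph\<close> asks for symmetry everywhere; truncation does
    not change the entropy.\<close>
  define E' where "E' = (\<lambda>u v. u < n \<and> v < n \<and> E u v)"
  interpret ugraph E'
    by unfold_locales (use assms(1) in \<open>auto simp: E'_def simple_graph_def\<close>)
  have "IG_sub n q f E' = IG_sub n q f E" for q f by (auto simp: IG_sub_def E'_def)
  then have eq: "entropy n E' = entropy n E" by (simp add: entropy_def guessing_number_def)
  have "good {..<n}" by (rule good_all) simp
  then obtain m h where m: "cover E' {..<n} m" "real n - real m / 6 = h"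
    "4 \<le> h \<or> h \<in> small_values \<and> UB E' {..<n} h"
    unfolding good_def by auto
  show ?thesis
  proof (cases "4 \<le> h")
    case True
    then show ?thesis using entropy_ge[OF m(1)] m(2) eq assms(2) by simp
  next
    case False
    then have h: "h \<in> small_values" "UB E' {..<n} h" using m(3) by auto
    then have "h \<ge> 0" by (auto simp: small_values_def)
    then have "entropy n E' = h" using entropy_eqI[OF h(2) m(1,2)] by blast
    then show ?thesis using h eq by simp
  qed
qed

section \<open>Graphs attaining the values\<close>

lemma entropy_complete: "entropy (Suc k) (\<lambda>u v. u \<noteq> v) = k"
proof (rule entropy_eqI)
  show "UB (\<lambda>u v. u \<noteq> v) {..<Suc k} (real k)"
    using UB_independent[of "{..<Suc k}" "{0}" "\<lambda>u v. u \<noteq> v"] by simp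
  show "cover (\<lambda>u v. u \<noteq> v) {..<Suc k} 6" by (rule cover_clique)
qed auto

definition sym_edges :: "(nat \<times> nat) set \<Rightarrow> nat \<Rightarrow> nat \<Rightarrow> bool" where
  "sym_edges S u v \<longleftrightarrow> u \<noteq> v \<and> ((u, v) \<in> S \<or> (v, u) \<in> S)"

lemma ugraph_sym_edges: "ugraph (sym_edges S)"
  by unfold_locales (auto simp: sym_edges_def)

lemma simple_graph_sym_edges: "simple_graph n (sym_edges S)"
  by (auto simp: simple_graph_def sym_edges_def)

lemma cover_cycle:
  assumes "n \<ge> 2"
  shows "cover (sym_edges {(i, Suc i mod n) | i. i < n}) {..<n} (3 * n)"
proof -
  interpret ugraph "sym_edges {(i, Suc i mod n) | i. i < n}" by (rule ugraph_sym_edges)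
  have "inj_on (\<lambda>i. Suc i mod n) {..<n}"
  proof (rule inj_onI)
    fix i j assume "i \<in> {..<n}" "j \<in> {..<n}" "Suc i mod n = Suc j mod n"
    then show "i = j" by (auto simp: mod_Suc split: if_splits)
  qed
  moreover have "i \<noteq> Suc i mod n" if "i < n" for i using that assms by (auto simp: mod_Suc)
  ultimately have "edge_perm (\<lambda>i. Suc i mod n) {..<n}"
    using assms by (auto simp: edge_perm_def sym_edges_def)
  from cover_edge_perm[OF this] show ?thesis by simp
qed

lemma entropy_C5: "entropy 5 (sym_edges {(i, Suc i mod 5) | i. i < 5}) = 5/2"
proof -
  let ?E = "sym_edges {(i, Suc i mod 5) | i. i < 5}"
  interpret ugraph ?E by (rule ugraph_sym_edges)
  show ?thesis
  proof (rule entropy_eqI)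
    show "cover ?E {..<5} 15" using cover_cycle[of 5] by simp
    have V: "{..<5} = {0,1,2,3,4::nat}" by auto
    show "UB ?E {..<5} (5/2)"
      by (rule UB_C5[OF V _ sym irr]) (auto simp: sym_edges_def mod_Suc)
  qed auto
qed

lemma entropy_C7: "entropy 7 (sym_edges {(i, Suc i mod 7) | i. i < 7}) = 7/2"
proof -
  let ?E = "sym_edges {(i, Suc i mod 7) | i. i < 7}"
  interpret ugraph ?E by (rule ugraph_sym_edges)
  show ?thesis
  proof (rule entropy_eqI)
    show "cover ?E {..<7} 21" using cover_cycle[of 7] by simp
    have V: "{..<7} = {0,1,2,3,4,5,6::nat}" by auto
    show "UB ?E {..<7} (7/2)"
      by (rule UB_C7_chords[OF V _ sym irr]) (auto simp: sym_edges_def mod_Suc)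
  qed auto
qed

text \<open>Vertices 0 to 4 form the pentagon; 5 and 6 play the roles of \<open>w\<close> and
  \<open>z\<close> in \<open>UB_C5_path_triangle\<close>.\<close>

lemma entropy_eleven_thirds:
  "entropy 7 (sym_edges {(0,1),(1,2),(2,3),(3,4),(4,0),(5,6),(5,0),(6,2),(6,3)}) = 11/3"
proof -
  let ?E = "sym_edges {(0,1),(1,2),(2,3),(3,4),(4,0),(5,6),(5,0),(6,2),(6,3)}"
  interpret ugraph ?E by (rule ugraph_sym_edges)
  have V: "{..<7} = {0,1,2,3,4,5,6::nat}" by auto
  show ?thesis
  proof (rule entropy_eqI)
    show "cover ?E {..<7} 20"
      by (rule cover_C5_path_triangle[OF V]) (auto simp: sym_edges_def)
    show "UB ?E {..<7} (11/3)"
      by (rule UB_C5_path_triangle[OF V _ sym irr]) (auto simp: sym_edges_def)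
  qed auto
qed

lemma entropy_setI: "simple_graph n E \<Longrightarrow> entropy n E = h \<Longrightarrow> h \<in> entropy_set"
  unfolding entropy_set_def by blast

theorem theorem4:
  shows "entropy_set \<inter> {0..4} = {0, 1, 2, 5/2, 3, 7/2, 11/3, 4}"
proof
  show "entropy_set \<inter> {0..4} \<subseteq> {0, 1, 2, 5/2, 3, 7/2, 11/3, 4}"
  proof
    fix h assume "h \<in> entropy_set \<inter> {0..4}"
    then obtain n E where "simple_graph n E" "entropy n E \<le> 4" "h = entropy n E"
      by (auto simp: entropy_set_def)
    then show "h \<in> {0, 1, 2, 5/2, 3, 7/2, 11/3, 4}"
      using entropy_small[of n E] unfolding small_values_def by blast
  qed
  have "real k \<in> entropy_set" for k
    by (rule entropy_setI[OF _ entropy_complete]) (auto simp: simple_graph_def)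
  from this[of 0] this[of 1] this[of 2] this[of 3] this[of 4]
  have "{0,1,2,3,4} \<subseteq> entropy_set" by simp
  moreover have "{5/2, 7/2, 11/3} \<subseteq> entropy_set"
    using entropy_setI[OF simple_graph_sym_edges] entropy_C5 entropy_C7 entropy_eleven_thirds by blast
  ultimately show "{0, 1, 2, 5/2, 3, 7/2, 11/3, 4} \<subseteq> entropy_set \<inter> {0..4}" by auto
qed

end
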